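(* Let $K\subset\hat{\mathbb{C}}$ be a compactum. For every $x\in K$, the fiber $\overline{R_K}[x]=\{y\in K: (x,y)\in\overline{R_K}\}$ is connected.
   Context: For disjoint simple closed curves $J_1,J_2\subset\hat{\mathbb{C}}$, $U(J_1,J_2)$ is the component of $\hat{\mathbb{C}}\setminus(J_1\cup J_2)$ with boundary $J_1\cup J_2$. The Schönflies relation $R_K\subset K\times K$: $x\ne y$ satisfy $(x,y)\in R_K$ if there exist disjoint simple closed curves $J_1\ni x$, $J_2\ni y$ such that $\overline{U(J_1,J_2)}\cap K$ contains an infinite sequence of distinct components $P_n$ each meeting both $J_1$ and $J_2$ whose Hausdorff limit contains $\{x,y\}$. $\overline{R_K}$ is the closure of $R_K$ in $K\times K$. *)

theory Defs
  imports "HOL-Analysis.Analysis"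
begin

text \<open>The Riemann sphere, modelled as the unit sphere in R^3 (homeomorphic to the
extended complex plane via stereographic projection).\<close>
definition riemann_sphere :: "(real^3) set" where
  "riemann_sphere = sphere 0 1"

definition simple_closed_curve :: "(real^3) set \<Rightarrow> bool" where
  "simple_closed_curve J \<longleftrightarrow>
     (\<exists>g. simple_path g \<and> pathfinish g = pathstart g \<and> path_image g = J
          \<and> J \<subseteq> riemann_sphere)"

definition is_U :: "(real^3) set \<Rightarrow> (real^3) set \<Rightarrow> (real^3) set \<Rightarrow> bool" where
  "is_U J1 J2 U \<longleftrightarrow>
     U \<in> components (riemann_sphere - (J1 \<union> J2)) \<and>
     (top_of_set riemann_sphere) frontier_of U = J1 \<union> J2"

definition hausdorff_converges :: "(nat \<Rightarrow> (real^3) set) \<Rightarrow> (real^3) set \<Rightarrow> bool" where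
  "hausdorff_converges P L \<longleftrightarrow>
     (\<forall>e>0. eventually (\<lambda>n. (\<forall>p\<in>P n. infdist p L < e) \<and> (\<forall>q\<in>L. infdist q (P n) < e))
                sequentially)"

definition schoenflies_rel :: "(real^3) set \<Rightarrow> ((real^3) \<times> (real^3)) set" where
  "schoenflies_rel K = {(x, y). x \<in> K \<and> y \<in> K \<and> x \<noteq> y \<and>
     (\<exists>J1 J2 U P L. simple_closed_curve J1 \<and> simple_closed_curve J2 \<and>
        J1 \<inter> J2 = {} \<and> x \<in> J1 \<and> y \<in> J2 \<and> is_U J1 J2 U \<and>
        inj P \<and> (\<forall>n. P n \<in> components (closure U \<inter> K)) \<and>
        (\<forall>n. P n \<inter> J1 \<noteq> {} \<and> P n \<inter> J2 \<noteq> {}) \<and>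
        compact L \<and> L \<noteq> {} \<and> hausdorff_converges P L \<and> x \<in> L \<and> y \<in> L)}"

end

theory Submission
  imports Defs "HOL-Complex_Analysis.Great_Picard"
begin

text \<open>
  The key point is that the whole limit of the components is related: if \<open>(a, b)\<close> is in the relation
  through components \<open>P n\<close>, then any two distinct points \<open>x\<close>, \<open>z\<close> that are limits of points of the
  \<open>P n\<close> form a pair in the closure of the relation, witnessed by small circles about \<open>x\<close> and \<open>z\<close>.
  Indeed only finitely many \<open>P n\<close> can, between these circles, touch the original curves away from
  the circles: near a point of such a curve, three of them together with the far side of the curve
  and the two discs would give a planar drawing of the complete bipartite graph on 3 + 3 vertices.

  If a fiber of \<open>x\<close> were split by disjoint open sets \<open>W\<close> and \<open>V\<close> with \<open>x \<in> W\<close>, then for pairs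
  \<open>(x\<^sub>k, y\<^sub>k) \<rightarrow> (x, y)\<close> of the relation with \<open>y \<in> V\<close> the connected sets \<open>P n\<close> leave \<open>W \<union> V\<close>; a limit
  point \<open>l\<^sub>k\<close> outside \<open>W \<union> V\<close> is related to \<open>x\<^sub>k\<close>, and a limit of the \<open>l\<^sub>k\<close> is a point of the fiber
  outside \<open>W \<union> V\<close>. Since only the part not containing \<open>x\<close> is used, it does not matter that the
  relation is irreflexive.
\<close>

subsection \<open>Theta graphs in the plane\<close>

text \<open>Both outsides are connected and contain a far away point \<open>b\<close>, so
  \<open>z\<close> is joined to \<open>b\<close> off \<open>S\<close> and off \<open>T\<close>. As
  \<open>S \<inter> T\<close> is connected, Janiszewski's theorem joins them off the union.\<close>

lemma Janiszewski_outside: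
  fixes z :: complex
  assumes "compact S" "compact T" "connected (S \<inter> T)" "z \<in> outside S" "z \<in> outside T"
  shows "z \<in> outside (S \<union> T)"
proof -
  have "bounded (S \<union> T)" using assms compact_imp_bounded by blast
  then obtain B where B: "S \<union> T \<subseteq> ball 0 B"
    using bounded_subset_ballD by blast
  \<comment> \<open>The norm of \<open>b\<close> is at least \<open>B\<close> whatever the sign of
    \<open>B\<close>.\<close>
  define b :: complex where "b = of_real \<bar>B\<bar>"
  have "b \<in> - ball 0 B" by (simp add: b_def)
  moreover have "- ball 0 B \<subseteq> outside R" if "R \<subseteq> S \<union> T" for R
    using B that by (intro outside_subset_convex) auto
  ultimately have b: "b \<in> outside S" "b \<in> outside T" "b \<in> outside (S \<union> T)"
    by blast+
  have "connected_component (- R) z b" if "R = S \<or> R = T" for R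
  proof -
    have "connected (outside R)"
      using that assms compact_imp_bounded by (intro connected_outside) auto
    moreover have "outside R \<subseteq> - R" using outside_no_overlap[of R] by blast
    ultimately show ?thesis
      using that assms b unfolding connected_component_def by blast
  qed
  then have "connected_component (- (S \<union> T)) z b"
    using Janiszewski[of S T z b] assms compact_imp_closed by blast
  then show ?thesis
    using b(3) connected_component_sym outside_same_component by blast
qed

text \<open>The component of \<open>t\<close> off \<open>A \<union> B\<close> lies inside, so it
  avoids \<open>C\<close>; symmetrically the one off \<open>A \<union> C\<close> avoids
  \<open>B\<close>. Hence the two coincide, their frontier lies in
  \<open>(A \<union> B) \<inter> (A \<union> C)\<close>, that is in \<open>A\<close>, and the
  bounded component cannot grow when only \<open>A\<close> is deleted.\<close>

lemma inside_common_frontier: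
  fixes t :: "'a::euclidean_space"
  assumes "closed A" "closed B" "closed C" "B \<inter> C \<subseteq> A"
    and t: "t \<in> inside (A \<union> B)" "t \<in> inside (A \<union> C)"
    and C: "C \<subseteq> A \<union> outside (A \<union> B)" and B: "B \<subseteq> A \<union> outside (A \<union> C)"
  shows "t \<in> inside A"
proof -
  let ?T = "connected_component_set (- (A \<union> B)) t"
  let ?T' = "connected_component_set (- (A \<union> C)) t"
  have nt: "t \<notin> A \<union> B" "t \<notin> A \<union> C" using t inside_no_overlap by blast+
  have sub: "?T \<subseteq> inside (A \<union> B)" "?T' \<subseteq> inside (A \<union> C)"
    using t inside_same_component by blast+
  have "?T \<subseteq> - (A \<union> B)" "?T' \<subseteq> - (A \<union> C)" by (rule connected_component_subset)+
  then have "?T \<subseteq> - (A \<union> C)" "?T' \<subseteq> - (A \<union> B)"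
    using sub C B inside_Int_outside by blast+
  then have "?T \<subseteq> ?T'" "?T' \<subseteq> ?T"
    using nt by (simp_all only: connected_component_maximal connected_connected_component
        connected_component_refl_eq mem_Collect_eq Compl_iff simp_thms)
  then have eq: "?T = ?T'" by blast
  have "frontier ?T \<subseteq> A \<union> B" "frontier ?T' \<subseteq> A \<union> C"
    using frontier_of_connected_component_subset[of "- (A \<union> B)" t]
      frontier_of_connected_component_subset[of "- (A \<union> C)" t]
      frontier_subset_closed[of "A \<union> B"] frontier_subset_closed[of "A \<union> C"] assms
    unfolding frontier_complement by blast+
  then have fr: "frontier ?T \<subseteq> A" using eq assms(4) by auto
  have bd: "bounded ?T" using t(1) unfolding inside_def by auto
  have "connected_component_set (- A) t \<subseteq> ?T"
  proof (rule ccontr)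
    assume "\<not> ?thesis"
    then have "connected_component_set (- A) t \<inter> frontier ?T \<noteq> {}"
      using nt connected_component_refl[of t "- A"] connected_component_refl[of t "- (A \<union> B)"]
      by (intro connected_Int_frontier) blast+
    then show False using fr connected_component_subset by fast
  qed
  then show ?thesis using bd nt bounded_subset unfolding inside_def by auto
qed

text \<open>Each curve is replaced by its filling. The union of the fillings does not separate the plane,
  so unicoherence (\<^term>\<open>unicoherent\<close>, via \<open>Janiszewski_dual\<close>) would make \<open>{a, b}\<close> connected.\<close>
lemma theta_plane:
  fixes C1 C2 C3 :: "complex set"
  assumes cc: "compact C1" "compact C2" "compact C3" "connected C1" "connected C2" "connected C3"
    and int: "C1 \<inter> C2 = {a, b}" "C1 \<inter> C3 = {a, b}" "C2 \<inter> C3 = {a, b}" and ab: "a \<noteq> b"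
    and out: "C1 \<subseteq> {a, b} \<union> outside (C2 \<union> C3)" "C2 \<subseteq> {a, b} \<union> outside (C1 \<union> C3)"
      "C3 \<subseteq> {a, b} \<union> outside (C1 \<union> C2)"
  shows False
proof -
  let ?E = "\<lambda>C::complex set. C \<union> inside C"
  \<comment> \<open>A pair of points does not separate the plane: two disjoint singletons fall under
    \<open>Janiszewski_outside\<close>, the empty intersection being connected.\<close>
  have in_ab: "inside {a, b} = {}"
  proof -
    have "z \<in> outside {a, b}" if "z \<notin> {a, b}" for z
      using that Janiszewski_outside[of "{a}" "{b}" z] ab by (auto simp: insert_commute)
    then show ?thesis using inside_outside[of "{a, b}"] by auto
  qed
  have cE: "compact (?E C)" "connected (?E C)" if "compact C" "connected C" for C
  proof -
    have "closed (?E C)"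
      using that by (simp add: union_with_inside closed_Compl compact_imp_closed open_outside)
    moreover have "bounded (?E C)" using that by (simp add: bounded_inside compact_imp_bounded)
    ultimately show "compact (?E C)" using compact_eq_bounded_closed by blast
    show "connected (?E C)" using that by (simp add: compact_imp_closed connected_with_inside)
  qed
  \<comment> \<open>Fillings meet in the common endpoints only: a point inside both continua would,
    by \<open>inside_common_frontier\<close> with \<open>A = {a, b}\<close>, lie inside a pair of
    points.\<close>
  have E_int: "?E X \<inter> ?E Y = {a, b}"
    if "compact X" "compact Y" "X \<inter> Y = {a, b}" "X \<subseteq> {a, b} \<union> outside Y" "Y \<subseteq> {a, b} \<union> outside X"
    for X Y
  proof -
    have "inside X \<inter> inside Y = {}"
    proof -
      have "t \<in> inside {a, b}" if "t \<in> inside X" "t \<in> inside Y" for t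
      proof (rule inside_common_frontier[of "{a, b}" X Y])
        have e: "{a, b} \<union> X = X" "{a, b} \<union> Y = Y" using \<open>X \<inter> Y = {a, b}\<close> by auto
        show "t \<in> inside ({a, b} \<union> X)" "t \<in> inside ({a, b} \<union> Y)" using that e by auto
        show "Y \<subseteq> {a, b} \<union> outside ({a, b} \<union> X)" "X \<subseteq> {a, b} \<union> outside ({a, b} \<union> Y)"
          using \<open>X \<subseteq> _\<close> \<open>Y \<subseteq> _\<close> unfolding e by auto
      qed (use \<open>compact X\<close> \<open>compact Y\<close> \<open>X \<inter> Y = {a, b}\<close> compact_imp_closed in auto)
      then show ?thesis using in_ab by blast
    qed
    moreover have "X \<inter> inside Y = {}" "Y \<inter> inside X = {}"
      using that inside_Int_outside[of X] inside_Int_outside[of Y]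
        inside_no_overlap[of X] inside_no_overlap[of Y] by fast+
    ultimately show ?thesis using \<open>X \<inter> Y = {a, b}\<close> by blast
  qed
  have out': "C1 \<subseteq> {a, b} \<union> outside C2" "C1 \<subseteq> {a, b} \<union> outside C3"
    "C2 \<subseteq> {a, b} \<union> outside C1" "C2 \<subseteq> {a, b} \<union> outside C3"
    "C3 \<subseteq> {a, b} \<union> outside C1" "C3 \<subseteq> {a, b} \<union> outside C2"
    using out outside_mono[of C2 "C2 \<union> C3"] outside_mono[of C3 "C2 \<union> C3"]
      outside_mono[of C1 "C1 \<union> C3"] outside_mono[of C3 "C1 \<union> C3"]
      outside_mono[of C1 "C1 \<union> C2"] outside_mono[of C2 "C1 \<union> C2"] by blast+
  let ?\<theta> = "C1 \<union> C2 \<union> C3"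
  \<comment> \<open>Off the fillings nothing bounded remains, which makes this complement connected
    and unicoherence applicable.\<close>
  have compl: "- (?E C1 \<union> (?E C2 \<union> ?E C3)) = outside ?\<theta>"
  proof
    show "outside ?\<theta> \<subseteq> - (?E C1 \<union> (?E C2 \<union> ?E C3))"
      using outside_mono[of C1 ?\<theta>] outside_mono[of C2 ?\<theta>] outside_mono[of C3 ?\<theta>]
      unfolding union_with_inside by blast
  next
    show "- (?E C1 \<union> (?E C2 \<union> ?E C3)) \<subseteq> outside ?\<theta>"
    proof
      fix z assume z: "z \<in> - (?E C1 \<union> (?E C2 \<union> ?E C3))"
      have False if nz: "z \<notin> outside ?\<theta>"
      proof -
        \<comment> \<open>For \<open>z\<close> off the fillings, exactly one of the two cycles
          through \<open>X\<close> leaves \<open>z\<close> outside. If both did, Janiszewski would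
          put \<open>z\<close> outside the whole graph, as the cycles meet in the connected set
          \<open>X\<close>; if neither did, \<open>z\<close> would be inside
          \<open>X\<close>.\<close>
        have split: "z \<in> outside (X \<union> Y) \<and> z \<notin> outside (X \<union> Z) \<or> z \<in> outside (X \<union> Z) \<and> z \<notin> outside (X \<union> Y)"
          if "X \<union> Y \<union> Z = ?\<theta>" "X \<inter> Y = {a, b}" "Y \<inter> Z = {a, b}" "X \<inter> Z = {a, b}"
            "compact X" "compact Y" "compact Z" "connected X" "z \<notin> ?E X"
            "Y \<subseteq> {a, b} \<union> outside (X \<union> Z)" "Z \<subseteq> {a, b} \<union> outside (X \<union> Y)" for X Y Z
        proof -
          have eq: "(X \<union> Y) \<inter> (X \<union> Z) = X" "(X \<union> Y) \<union> (X \<union> Z) = ?\<theta>"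
            using that(1-4) by blast+
          have ab: "{a, b} \<subseteq> X" using that(2) by blast
          have nzX: "z \<notin> X \<union> Y" "z \<notin> X \<union> Z" using z that(1) by blast+
          have "\<not> (z \<in> outside (X \<union> Y) \<and> z \<in> outside (X \<union> Z))"
            using Janiszewski_outside[of "X \<union> Y" "X \<union> Z" z] that(5-8) nz unfolding eq by auto
          moreover have "\<not> (z \<in> inside (X \<union> Y) \<and> z \<in> inside (X \<union> Z))"
          proof
            assume "z \<in> inside (X \<union> Y) \<and> z \<in> inside (X \<union> Z)"
            then have "z \<in> inside (X \<union> Y)" "z \<in> inside (X \<union> Z)" by blast+
            moreover have "closed X" "closed Y" "closed Z" using that(5-7) compact_imp_closed by blast+
            moreover have "Y \<inter> Z \<subseteq> X" using that(3) ab by blast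
            moreover have "Z \<subseteq> X \<union> outside (X \<union> Y)" "Y \<subseteq> X \<union> outside (X \<union> Z)"
              using that(10,11) ab by blast+
            ultimately have "z \<in> inside X" using inside_common_frontier by metis
            then show False using that(9) by blast
          qed
          moreover have "z \<in> inside W \<longleftrightarrow> z \<notin> outside W" if "z \<notin> W" for W
            using that inside_outside[of W] by blast
          ultimately show ?thesis using nzX by metis
        qed
        have zE: "z \<notin> ?E C1" "z \<notin> ?E C2" "z \<notin> ?E C3" using z by blast+
        have "z \<in> outside (C1 \<union> C2) \<and> z \<notin> outside (C1 \<union> C3) \<or> z \<in> outside (C1 \<union> C3) \<and> z \<notin> outside (C1 \<union> C2)"
          by (rule split) (simp_all only: zE int cc out simp_thms)
        moreover have "z \<in> outside (C2 \<union> C1) \<and> z \<notin> outside (C2 \<union> C3) \<or> z \<in> outside (C2 \<union> C3) \<and> z \<notin> outside (C2 \<union> C1)"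
          by (rule split) (use zE int cc out in \<open>simp_all only: Un_ac Int_ac simp_thms\<close>)
        moreover have "z \<in> outside (C3 \<union> C1) \<and> z \<notin> outside (C3 \<union> C2) \<or> z \<in> outside (C3 \<union> C2) \<and> z \<notin> outside (C3 \<union> C1)"
          by (rule split) (use zE int cc out in \<open>simp_all only: Un_ac Int_ac simp_thms\<close>)
        \<comment> \<open>Membership of \<open>z\<close> in the three outsides of
          \<open>C1 \<union> C2\<close>, \<open>C1 \<union> C3\<close> and
          \<open>C2 \<union> C3\<close> would need three pairwise different truth values.\<close>
        ultimately show False by (simp only: Un_ac) argo
      qed
      then show "z \<in> outside ?\<theta>" by blast
    qed
  qed
  have "connected (?E C1 \<inter> (?E C2 \<union> ?E C3))"
  proof (rule Janiszewski_dual)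
    show "connected (?E C2 \<union> ?E C3)"
      using int by (intro connected_Un cE cc) blast
    have "bounded ?\<theta>" using cc by (simp add: compact_imp_bounded)
    then show "connected (- (?E C1 \<union> (?E C2 \<union> ?E C3)))"
      unfolding compl by (intro connected_outside) simp_all
  qed (simp_all only: cE cc compact_Un)
  moreover have "?E C1 \<inter> (?E C2 \<union> ?E C3) = {a, b}"
    using E_int[of C1 C2] E_int[of C1 C3] cc int out' by blast
  ultimately have "connected {a, b}" by metis
  then show False using ab connected_finite_iff_sing[of "{a, b}"] by auto
qed


subsection \<open>Separation of the sphere\<close>

abbreviation "S2 \<equiv> sphere (0::real^3) 1"

lemma stereographic_projection:
  assumes "p \<in> S2"
  obtains h :: "real^3 \<Rightarrow> complex" and k where "homeomorphism (S2 - {p}) UNIV h k"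
proof -
  have "(S2 - {p}) homeomorphic (UNIV :: complex set)"
    using assms by (intro homeomorphic_punctured_sphere_affine) auto
  then show ?thesis using that unfolding homeomorphic_def by blast
qed

text \<open>Components of the sphere are read off in the plane with the base point \<open>p\<close> sent to infinity,
  so that being joined to \<open>p\<close> becomes membership in \<^const>\<open>outside\<close>.\<close>
lemma connected_component_sphere_iff_outside:
  fixes h :: "real^3 \<Rightarrow> complex"
  assumes hk: "homeomorphism (S2 - {p}) UNIV h k" and p: "p \<in> S2"
    and T: "compact T" "T \<subseteq> S2 - {p}" and q: "q \<in> S2 - {p}"
  shows "connected_component (S2 - T) p q \<longleftrightarrow> h q \<in> outside (h ` T)"
proof
  have kh: "k (h y) = y" if "y \<in> S2 - {p}" for y
    using hk that unfolding homeomorphism_def by blast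
  have hk': "h (k y) = y" for y using hk unfolding homeomorphism_def by blast
  have kS: "k y \<in> S2 - {p}" for y using hk unfolding homeomorphism_def by blast
  have ck: "continuous_on A k" for A
    using hk unfolding homeomorphism_def by (meson continuous_on_subset subset_UNIV)
  have ch: "continuous_on A h" if "A \<subseteq> S2 - {p}" for A
    using hk that unfolding homeomorphism_def by (meson continuous_on_subset)
  have cT: "compact (h ` T)" using ch T compact_continuous_image by blast
  show "h q \<in> outside (h ` T)" if "connected_component (S2 - T) p q"
  proof (rule ccontr)
    assume no: "h q \<notin> outside (h ` T)"
    obtain E where E: "connected E" "E \<subseteq> S2 - T" "p \<in> E" "q \<in> E"
      using \<open>connected_component (S2 - T) p q\<close> unfolding connected_component_def by blast
    have khT: "k ` h ` T = T" using kh T(2) by (simp add: image_image subset_iff)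
    have "h q \<notin> h ` T" using E(2,4) kh[OF q] khT by (metis DiffE image_eqI subsetD)
    then have hq: "h q \<in> inside (h ` T)" using no inside_outside by blast
    \<comment> \<open>\<open>M\<close> is the bounded complementary component of \<open>h q\<close>.
      Its image under \<open>k\<close> is open in the sphere, and its closure adds only points of
      \<open>T\<close> there; so \<open>O1\<close>, around \<open>q\<close>, and \<open>O2\<close>,
      around \<open>p\<close>, disconnect \<open>E\<close>.\<close>
    define M where "M = connected_component_set (- h ` T) (h q)"
    have hqM: "h q \<in> M" unfolding M_def using \<open>h q \<notin> h ` T\<close> by simp
    have M: "open M" "bounded M" "M \<inter> h ` T = {}" "frontier M \<subseteq> h ` T"
    proof -
      show "open M" unfolding M_def
        using cT by (simp add: compact_imp_closed open_Compl open_connected_component)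
      show "bounded M" using hq unfolding M_def inside_def by auto
      show "M \<inter> h ` T = {}" unfolding M_def using connected_component_subset by fast
      show "frontier M \<subseteq> h ` T" unfolding M_def
        using frontier_of_connected_component_subset[of "- h ` T" "h q"]
          frontier_subset_closed[of "h ` T"] cT compact_imp_closed by auto
    qed
    have "openin (top_of_set (S2 - {p})) (k ` M)"
      using homeomorphism_imp_open_map[of UNIV "S2 - {p}" k h M] hk M(1)
      by (simp add: homeomorphism_symD)
    then obtain W where W: "open W" "k ` M = (S2 - {p}) \<inter> W" unfolding openin_open by blast
    define O1 where "O1 = W - {p}"
    have O1: "open O1" "k ` M = S2 \<inter> O1" unfolding O1_def using W by auto
    define O2 where "O2 = - k ` (closure M)"
    have "compact (k ` (closure M))" using M(2) ck compact_continuous_image compact_closure by blast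
    then have O2: "open O2" unfolding O2_def by (simp add: compact_imp_closed open_Compl)
    have sub: "k ` closure M \<subseteq> k ` M \<union> T"
    proof -
      have "closure M \<subseteq> M \<union> h ` T" using M(4) closure_Un_frontier by blast
      then have "k ` closure M \<subseteq> k ` M \<union> k ` h ` T" by blast
      then show ?thesis unfolding khT .
    qed
    have 1: "E \<subseteq> O1 \<union> O2"
      using E sub O1 unfolding O2_def by blast
    have 2: "O1 \<inter> O2 \<inter> E = {}"
      using E O1 closure_subset[of M] unfolding O2_def by blast
    have "q \<in> k ` M" using hqM kh q by (metis image_iff)
    then have 3: "O1 \<inter> E \<noteq> {}" using E O1 by blast
    have "p \<notin> k ` closure M" using kS by blast
    then have 4: "O2 \<inter> E \<noteq> {}" using E unfolding O2_def by blast
    show False using connectedD[OF E(1) O1(1) O2 2 1] 3 4 by blast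
  qed
  show "connected_component (S2 - T) p q" if hq: "h q \<in> outside (h ` T)"
  proof -
    let ?O = "outside (h ` T)"
    have "connected ?O" using cT by (intro connected_outside) (auto simp: compact_imp_bounded)
    then have ckO: "connected (k ` ?O)" using ck connected_continuous_image by blast
    \<comment> \<open>The outside is unbounded; were its image kept away from \<open>p\<close>, it
      would lie in the image under \<open>h\<close> of a compact part of the sphere.\<close>
    have "p \<in> closure (k ` ?O)"
    proof (rule ccontr)
      assume "p \<notin> closure (k ` ?O)"
      then obtain e where e: "e > 0" "ball p e \<inter> k ` ?O = {}"
        by (metis closure_approachable disjoint_iff mem_ball dist_commute)
      have cp: "compact (S2 - ball p e)" by (simp add: compact_diff)
      have "?O \<subseteq> h ` (S2 - ball p e)"
      proof
        fix y assume "y \<in> ?O"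
        then have "k y \<in> S2 - ball p e" using e kS by blast
        then show "y \<in> h ` (S2 - ball p e)" using hk' by (metis image_eqI)
      qed
      moreover have "bounded (h ` (S2 - ball p e))"
      proof (intro compact_imp_bounded compact_continuous_image cp ch)
        show "S2 - ball p e \<subseteq> S2 - {p}" using e(1) by auto
      qed
      ultimately have "bounded ?O" using bounded_subset by blast
      then show False using unbounded_outside[of "h ` T"] cT compact_imp_bounded by blast
    qed
    then have "connected (insert p (k ` ?O))"
      using closure_subset[of "k ` ?O"] by (intro connected_intermediate_closure[OF ckO]) blast+
    moreover have "insert p (k ` ?O) \<subseteq> S2 - T"
    proof -
      have "k y \<notin> T" if "y \<in> ?O" for y
        using that hk' outside_no_overlap[of "h ` T"] by (metis disjoint_iff image_eqI)
      then show ?thesis using p T kS by auto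
    qed
    moreover have "q \<in> k ` ?O" using hq kh q by (metis image_iff)
    ultimately show ?thesis unfolding connected_component_def by blast
  qed
qed


text \<open>The point sent to infinity is \<open>p\<close> itself, so that the hypotheses on
  \<open>p\<close> and \<open>q\<close> and the conclusion become membership of \<open>h q\<close>
  in an outside.\<close>

lemma sphere_Janiszewski:
  assumes "compact S" "compact T" "S \<subseteq> S2" "T \<subseteq> S2" "connected (S \<inter> T)"
    and pq: "connected_component (S2 - S) p q" "connected_component (S2 - T) p q"
  shows "connected_component (S2 - (S \<union> T)) p q"
proof (cases "p = q")
  case True
  then show ?thesis using pq connected_component_in by (simp add: connected_component_refl_eq)
next
  case False
  have p: "p \<in> S2" "p \<notin> S" "p \<notin> T" and q: "q \<in> S2 - {p}"
    using pq connected_component_in False by blast+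
  obtain h k where hk: "homeomorphism (S2 - {p}) (UNIV :: complex set) h k"
    using stereographic_projection[OF p(1)] by blast
  have sub: "S \<subseteq> S2 - {p}" "T \<subseteq> S2 - {p}" "S \<union> T \<subseteq> S2 - {p}" using assms p by blast+
  have ch: "continuous_on A h" if "A \<subseteq> S2 - {p}" for A
    using hk that unfolding homeomorphism_def by (meson continuous_on_subset)
  have "inj_on h (S2 - {p})"
    using hk unfolding homeomorphism_def by (metis inj_on_inverseI)
  then have "h ` (S \<inter> T) = h ` S \<inter> h ` T" using sub by (simp add: inj_on_image_Int)
  moreover have "connected (h ` (S \<inter> T))"
    using assms(5) ch[of "S \<inter> T"] sub by (intro connected_continuous_image) blast+
  ultimately have "h q \<in> outside (h ` S \<union> h ` T)"
    using connected_component_sphere_iff_outside[OF hk p(1) _ _ q] assms sub pq ch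
    by (intro Janiszewski_outside) (auto intro: compact_continuous_image)
  then have "h q \<in> outside (h ` (S \<union> T))" by (simp only: image_Un)
  then show ?thesis
    using connected_component_sphere_iff_outside[OF hk p(1) _ sub(3) q] assms by blast
qed

text \<open>With \<open>p\<close> at infinity this is \<open>theta_plane\<close>; \<open>p\<close>
  acts as a third pole next to \<open>a\<close> and \<open>b\<close>.\<close>

lemma sphere_theta:
  assumes cc: "compact C1" "compact C2" "compact C3" "connected C1" "connected C2" "connected C3"
    and S2: "C1 \<subseteq> S2" "C2 \<subseteq> S2" "C3 \<subseteq> S2" and p: "p \<in> S2 - (C1 \<union> C2 \<union> C3)"
    and int: "C1 \<inter> C2 = {a, b}" "C1 \<inter> C3 = {a, b}" "C2 \<inter> C3 = {a, b}" and ab: "a \<noteq> b"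
    and out: "C1 \<subseteq> {a, b} \<union> connected_component_set (S2 - (C2 \<union> C3)) p"
      "C2 \<subseteq> {a, b} \<union> connected_component_set (S2 - (C1 \<union> C3)) p"
      "C3 \<subseteq> {a, b} \<union> connected_component_set (S2 - (C1 \<union> C2)) p"
  shows False
proof -
  obtain h k where hk: "homeomorphism (S2 - {p}) (UNIV :: complex set) h k"
    using stereographic_projection p by blast
  have sub: "C1 \<subseteq> S2 - {p}" "C2 \<subseteq> S2 - {p}" "C3 \<subseteq> S2 - {p}" using S2 p by blast+
  have ch: "continuous_on A h" if "A \<subseteq> S2 - {p}" for A
    using hk that unfolding homeomorphism_def by (meson continuous_on_subset)
  have inj: "inj_on h (S2 - {p})"
    using hk unfolding homeomorphism_def by (metis inj_on_inverseI)
  have ab': "{a, b} \<subseteq> S2 - {p}" using sub(1) unfolding int(1)[symmetric] by blast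
  have out': "h ` X \<subseteq> {h a, h b} \<union> outside (h ` Y \<union> h ` Z)"
    if "X \<subseteq> {a, b} \<union> connected_component_set (S2 - (Y \<union> Z)) p" "compact Y" "compact Z"
      "X \<subseteq> S2 - {p}" "Y \<subseteq> S2 - {p}" "Z \<subseteq> S2 - {p}" for X Y Z
  proof
    fix y assume "y \<in> h ` X"
    then obtain q where q: "q \<in> X" "y = h q" by blast
    show "y \<in> {h a, h b} \<union> outside (h ` Y \<union> h ` Z)"
    proof (cases "q \<in> {a, b}")
      case False
      then have "connected_component (S2 - (Y \<union> Z)) p q" using that(1) q by blast
      moreover have "compact (Y \<union> Z)" "Y \<union> Z \<subseteq> S2 - {p}" "q \<in> S2 - {p}"
        using that(2-6) q(1) by (simp_all only: compact_Un Un_subset_iff simp_thms subsetD)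
      ultimately have "h q \<in> outside (h ` (Y \<union> Z))"
        using connected_component_sphere_iff_outside[OF hk, of "Y \<union> Z" q] p by blast
      then show ?thesis using q by (simp add: image_Un)
    qed (use q in blast)
  qed
  show False
  proof (rule theta_plane[of "h ` C1" "h ` C2" "h ` C3" "h a" "h b"])
    show "compact (h ` C1)" "compact (h ` C2)" "compact (h ` C3)"
      using cc sub ch compact_continuous_image by blast+
    show "connected (h ` C1)" "connected (h ` C2)" "connected (h ` C3)"
      using cc sub ch connected_continuous_image by blast+
    show "h ` C1 \<inter> h ` C2 = {h a, h b}" "h ` C1 \<inter> h ` C3 = {h a, h b}" "h ` C2 \<inter> h ` C3 = {h a, h b}"
      using inj_on_image_Int[OF inj sub(1,2)] inj_on_image_Int[OF inj sub(1,3)]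
        inj_on_image_Int[OF inj sub(2,3)] unfolding int by simp_all
    show "h a \<noteq> h b" using ab inj ab' by (simp add: inj_on_eq_iff)
    show "h ` C1 \<subseteq> {h a, h b} \<union> outside (h ` C2 \<union> h ` C3)"
      by (rule out'[OF out(1) cc(2,3) sub(1,2,3)])
    show "h ` C2 \<subseteq> {h a, h b} \<union> outside (h ` C1 \<union> h ` C3)"
      by (rule out'[OF out(2) cc(1,3) sub(2,1,3)])
    show "h ` C3 \<subseteq> {h a, h b} \<union> outside (h ` C1 \<union> h ` C2)"
      by (rule out'[OF out(3) cc(1,2) sub(3,1,2)])
  qed
qed

section \<open>Jordan curves on the sphere\<close>

lemma simple_closed_curve_compact:
  assumes "simple_closed_curve J"
  shows "compact J" "J \<subseteq> S2"
  using assms unfolding simple_closed_curve_def riemann_sphere_def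
  by (metis compact_simple_path_image)+

text \<open>By the Jordan curve theorem, in the plane with \<open>p\<close> at infinity, the curve
  is the frontier of its inside and of its outside; thus every neighbourhood of \<open>w\<close>
  meets both.\<close>

lemma simple_closed_curve_both_sides:
  assumes J: "simple_closed_curve J" and p: "p \<in> S2 - J" and w: "w \<in> J" and V: "open V" "w \<in> V"
  shows "\<exists>q \<in> V. connected_component (S2 - J) p q"
    and "\<exists>q \<in> V \<inter> S2 - J. \<not> connected_component (S2 - J) p q"
proof -
  obtain h k where hk: "homeomorphism (S2 - {p}) (UNIV :: complex set) h k"
    using stereographic_projection p by blast
  obtain g where g: "simple_path g" "pathfinish g = pathstart g" "path_image g = J" and JS: "J \<subseteq> S2"
    using J unfolding simple_closed_curve_def riemann_sphere_def by blast
  have sub: "J \<subseteq> S2 - {p}" using JS p by blast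
  have ch: "continuous_on A h" if "A \<subseteq> S2 - {p}" for A
    using hk that unfolding homeomorphism_def by (meson continuous_on_subset)
  have inj: "inj_on h (S2 - {p})"
    using hk unfolding homeomorphism_def by (metis inj_on_inverseI)
  have cJ: "compact J" using g compact_simple_path_image by blast
  have c: "simple_path (h \<circ> g)" "pathfinish (h \<circ> g) = pathstart (h \<circ> g)" "path_image (h \<circ> g) = h ` J"
    using g sub ch[OF sub] inj by (auto intro!: simple_path_continuous_image inj_on_subset[OF inj]
        simp: pathfinish_compose pathstart_compose path_image_compose)
  have fr: "frontier (inside (h ` J)) = h ` J" "frontier (outside (h ` J)) = h ` J"
    using Jordan_inside_outside[OF c(1,2)] unfolding c(3) by auto
  let ?V = "h ` (V \<inter> (S2 - {p}))"
  have "open ?V"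
  proof -
    have "openin (top_of_set (S2 - {p})) (V \<inter> (S2 - {p}))" using V(1) by (metis Int_commute openin_open_Int)
    then have "openin (top_of_set UNIV) ?V" by (rule homeomorphism_imp_open_map[OF hk])
    then show ?thesis by simp
  qed
  moreover have "h w \<in> ?V" using w V sub by blast
  moreover have "h w \<in> closure (inside (h ` J))" "h w \<in> closure (outside (h ` J))"
    using fr w unfolding frontier_def by blast+
  ultimately have "?V \<inter> inside (h ` J) \<noteq> {}" "?V \<inter> outside (h ` J) \<noteq> {}"
    using open_Int_closure_eq_empty by blast+
  then obtain q q' where q: "q \<in> V \<inter> (S2 - {p})" "h q \<in> inside (h ` J)"
    and q': "q' \<in> V \<inter> (S2 - {p})" "h q' \<in> outside (h ` J)" by blast
  have "connected_component (S2 - J) p q'"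
    using connected_component_sphere_iff_outside[OF hk _ cJ sub, of q'] q' p by blast
  then show "\<exists>q \<in> V. connected_component (S2 - J) p q" using q' by blast
  have "h q \<notin> outside (h ` J)" "h q \<notin> h ` J"
    using q(2) inside_Int_outside inside_no_overlap by blast+
  then have "\<not> connected_component (S2 - J) p q" "q \<notin> J"
    using connected_component_sphere_iff_outside[OF hk _ cJ sub, of q] q p by blast+
  then show "\<exists>q \<in> V \<inter> S2 - J. \<not> connected_component (S2 - J) p q" using q by blast
qed


subsection \<open>Spherical caps\<close>

text \<open>Minor great-circle arc; degenerate when \<open>p = - x\<close>, since \<open>sgn 0 = 0\<close>.\<close>
definition sarc :: "real^3 \<Rightarrow> real^3 \<Rightarrow> (real^3) set" where
  "sarc x p = (\<lambda>t. sgn ((1 - t) *\<^sub>R x + t *\<^sub>R p)) ` {0..1}"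

lemma sphere_norm_dist:
  assumes "x \<in> S2" "y \<in> S2"
  shows "(dist x y)\<^sup>2 = 2 - 2 * (x \<bullet> y)" and "(dist (- x) y)\<^sup>2 = 2 + 2 * (x \<bullet> y)"
  using assms
  by (auto simp: dist_norm power2_norm_eq_inner inner_diff inner_commute norm_eq_1 inner_add
      inner_minus_left inner_minus_right algebra_simps)

lemma dist_antipode:
  assumes "x \<in> S2" "y \<in> S2"
  shows "dist (- x) y = sqrt (4 - (dist x y)\<^sup>2)"
proof -
  have "(dist (- x) y)\<^sup>2 = 4 - (dist x y)\<^sup>2" using sphere_norm_dist[OF assms] by simp
  then show ?thesis by (metis real_sqrt_unique zero_le_dist)
qed

lemma dist_sphere_less_iff:
  assumes "x \<in> S2" "y \<in> S2" "z \<in> S2"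
  shows "dist x y < dist x z \<longleftrightarrow> x \<bullet> z < x \<bullet> y"
proof -
  have "dist x y < dist x z \<longleftrightarrow> (dist x y)\<^sup>2 < (dist x z)\<^sup>2" 
    by (meson power2_less_imp_less power_strict_mono pos2 zero_le_dist)
  then show ?thesis using sphere_norm_dist(1)[OF assms(1,2)] sphere_norm_dist(1)[OF assms(1,3)] by simp
qed

lemma sarc_point_nonzero:
  assumes "x \<in> S2" "p \<in> S2" "p \<noteq> - x" "0 \<le> t" "t \<le> 1"
  shows "(1 - t) *\<^sub>R x + t *\<^sub>R p \<noteq> 0"
proof
  assume 0: "(1 - t) *\<^sub>R x + t *\<^sub>R p = 0"
  then have e: "t *\<^sub>R p = - ((1 - t) *\<^sub>R x)" by (metis add.commute add_eq_0_iff)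
  then have "norm (t *\<^sub>R p) = norm ((1 - t) *\<^sub>R x)" by simp
  then have "t = 1 - t" using assms by simp
  then have "t *\<^sub>R p = t *\<^sub>R (- x)" "t \<noteq> 0" using e by auto
  then have "p = - x" by (metis scaleR_cancel_left)
  then show False using assms by simp
qed

lemma sarc_decomp:
  assumes "x \<in> S2" "p \<in> S2" "p \<noteq> - x" "v \<in> sarc x p"
  obtains s t where "0 \<le> s" "0 \<le> t" "v = s *\<^sub>R x + t *\<^sub>R p" "v \<in> S2"
proof -
  obtain u where u: "0 \<le> u" "u \<le> 1" "v = sgn ((1 - u) *\<^sub>R x + u *\<^sub>R p)"
    using assms(4) unfolding sarc_def by auto
  let ?n = "norm ((1 - u) *\<^sub>R x + u *\<^sub>R p)"
  have nz: "(1 - u) *\<^sub>R x + u *\<^sub>R p \<noteq> 0" using sarc_point_nonzero assms u by blast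
  show thesis
  proof
    show "0 \<le> (1 - u) / ?n" "0 \<le> u / ?n" using u by auto
    show "v = ((1 - u) / ?n) *\<^sub>R x + (u / ?n) *\<^sub>R p"
      using u(3) by (simp add: sgn_div_norm scaleR_add_right divide_inverse mult.commute)
    show "v \<in> S2" using nz u(3) by (simp add: norm_sgn)
  qed
qed

text \<open>Here \<open>d\<close> stands for \<open>x \<bullet> p\<close>, the equation says that
  the combination \<open>v\<close> of \<open>x\<close> and \<open>p\<close> with coefficients
  \<open>s\<close> and \<open>t\<close> is a unit vector, and \<open>s + t * d\<close> is
  \<open>x \<bullet> v\<close>. So the arc stays no farther from \<open>x\<close> than its end
  \<open>p\<close>, and the equality case singles out \<open>p\<close>.\<close>

lemma arc_inner_bound:
  fixes s t d :: real
  assumes "0 \<le> s" "0 \<le> t" "-1 < d" "d < 1" and 1: "s\<^sup>2 + 2 * s * t * d + t\<^sup>2 = 1"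
  shows "d \<le> s + t * d" and "s + t * d = d \<Longrightarrow> s = 0 \<and> t = 1"
proof -
  \<comment> \<open>Pythagoras: the unit vector splits into its part along \<open>x\<close> and a
    rest of squared length \<open>t\<^sup>2 * (1 - d\<^sup>2)\<close>.\<close>
  have sq: "(s + t * d)\<^sup>2 = 1 - t\<^sup>2 * (1 - d\<^sup>2)" using 1 by (simp add: power2_eq_square algebra_simps)
  have d1: "d\<^sup>2 < 1" using assms by (simp add: abs_square_less_1 abs_less_iff)
  show "d \<le> s + t * d"
  proof (cases "d \<ge> 0")
    case True
    have "t \<le> 1"
    proof (rule ccontr)
      assume "\<not> t \<le> 1"
      then have "t\<^sup>2 > 1" by (simp add: one_less_power)
      moreover have "0 \<le> s\<^sup>2" "0 \<le> 2 * s * t * d" using assms True by simp_all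
      ultimately show False using 1 by linarith
    qed
    then have "t\<^sup>2 \<le> 1" using assms by (simp add: power_le_one)
    then have "t\<^sup>2 * (1 - d\<^sup>2) \<le> 1 * (1 - d\<^sup>2)" using d1 by (intro mult_right_mono) auto
    then have "d\<^sup>2 \<le> (s + t * d)\<^sup>2" using sq by simp
    then show ?thesis using assms True by (intro power2_le_imp_le[of d]) auto
  next
    case False
    show ?thesis
    proof (cases "t \<le> 1")
      case True
      then have "d \<le> t * d" using False by (simp add: mult_le_cancel_right1)
      then show ?thesis using assms by simp
    next
      case t: False
      then have "1 \<le> t\<^sup>2" by simp
      then have "1 * (1 - d\<^sup>2) \<le> t\<^sup>2 * (1 - d\<^sup>2)" using d1 by (intro mult_right_mono) auto
      then have "(s + t * d)\<^sup>2 \<le> d\<^sup>2" using sq by simp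
      then have "\<bar>s + t * d\<bar> \<le> \<bar>d\<bar>" by (simp add: abs_le_square_iff)
      then show ?thesis using False by simp
    qed
  qed
  assume e: "s + t * d = d"
  have "d\<^sup>2 = 1 - t\<^sup>2 * (1 - d\<^sup>2)" using sq unfolding e .
  moreover have "X = 1 * (1 - a)" if "a = 1 - X" for a X :: real using that by simp
  ultimately have "t\<^sup>2 * (1 - d\<^sup>2) = 1 * (1 - d\<^sup>2)" by blast
  moreover have "1 - d\<^sup>2 \<noteq> 0" using d1 by simp
  ultimately have "t\<^sup>2 = 1" by (metis mult_right_cancel)
  then have "t = 1" using assms by (simp add: power2_eq_1_iff)
  then show "s = 0 \<and> t = 1" using e by simp
qed

lemma dist_between_inner:
  assumes "x \<in> S2" "p \<in> S2" "0 < dist x p" "dist x p < 2"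
  shows "-1 < x \<bullet> p" "x \<bullet> p < 1" "p \<noteq> x" "p \<noteq> - x"
proof -
  have "(dist x p)\<^sup>2 < 2\<^sup>2" "0 < (dist x p)\<^sup>2"
    using power_strict_mono[OF assms(4), of 2] assms(3) by simp_all
  then show i: "-1 < x \<bullet> p" "x \<bullet> p < 1" using sphere_norm_dist(1)[OF assms(1,2)] by auto
  show "p \<noteq> x" using assms by auto
  show "p \<noteq> - x" using i assms by (auto simp: norm_eq_1)
qed

lemma continuous_on_sarc:
  assumes "x \<in> S2" "p \<in> S2" "p \<noteq> - x" "A \<subseteq> {0..1}"
  shows "continuous_on A (\<lambda>t. sgn ((1 - t) *\<^sub>R x + t *\<^sub>R p))"
  unfolding sgn_div_norm using sarc_point_nonzero[OF assms(1-3)] assms(4)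
  by (intro continuous_intros) (auto simp: subset_iff)

text \<open>The last two items prepare gluing: off \<open>p\<close> the arc stays in the open cap,
  so it meets a set outside that cap at most in \<open>p\<close>; and it remains connected once the
  centre \<open>x\<close> is deleted.\<close>

lemma sarc:
  assumes "x \<in> S2" "p \<in> S2" "0 < dist x p" "dist x p < 2"
  shows "compact (sarc x p)" "connected (sarc x p)" "x \<in> sarc x p" "p \<in> sarc x p"
    "sarc x p \<subseteq> S2" "sarc x p - {p} \<subseteq> ball x (dist x p)" "connected (sarc x p - {x})"
proof -
  note i = dist_between_inner[OF assms]
  have c: "continuous_on A (\<lambda>t. sgn ((1 - t) *\<^sub>R x + t *\<^sub>R p))" if "A \<subseteq> {0..1}" for A
    using continuous_on_sarc assms i that by blast
  show "compact (sarc x p)" "connected (sarc x p)" unfolding sarc_def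
    using c by (auto intro!: compact_continuous_image connected_continuous_image)
  have sx: "sgn x = x" "sgn p = p" using assms by (auto simp: sgn_div_norm)
  show "x \<in> sarc x p" unfolding sarc_def by (rule image_eqI[of _ _ 0]) (auto simp: sx)
  show "p \<in> sarc x p" unfolding sarc_def by (rule image_eqI[of _ _ 1]) (auto simp: sx)
  show "sarc x p \<subseteq> S2" using sarc_decomp[OF assms(1,2) i(4)] by blast
  show "sarc x p - {p} \<subseteq> ball x (dist x p)"
  proof
    fix v assume v: "v \<in> sarc x p - {p}"
    then obtain s t where st: "0 \<le> s" "0 \<le> t" "v = s *\<^sub>R x + t *\<^sub>R p" "v \<in> S2"
      using sarc_decomp[OF assms(1,2) i(4)] by blast
    have xx: "x \<bullet> x = 1" "p \<bullet> p = 1" "v \<bullet> v = 1" using assms st by (auto simp: norm_eq_1)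
    have "s\<^sup>2 + 2 * s * t * (x \<bullet> p) + t\<^sup>2 = 1"
      using xx(3) unfolding st(3) 
      by (simp add: inner_add xx(1,2) inner_commute power2_eq_square algebra_simps)
    from arc_inner_bound[OF st(1,2) i(1,2) this]
    have "x \<bullet> p \<le> s + t * (x \<bullet> p)" "s + t * (x \<bullet> p) = x \<bullet> p \<Longrightarrow> v = p" using st(3) by auto
    moreover have "x \<bullet> v = s + t * (x \<bullet> p)" unfolding st(3) by (simp add: inner_add xx)
    ultimately have "x \<bullet> p < x \<bullet> v" using v by force
    then show "v \<in> ball x (dist x p)" using dist_sphere_less_iff assms st by simp
  qed
  \<comment> \<open>Deleting \<open>x\<close> deletes the parameter 0 alone: another parameter
    giving \<open>x\<close> would make \<open>p\<close> a multiple of \<open>x\<close>, hence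
    \<open>x\<close> or \<open>- x\<close>.\<close>
  have "sarc x p - {x} = (\<lambda>t. sgn ((1 - t) *\<^sub>R x + t *\<^sub>R p)) ` {0<..1}"
  proof -
    have "sgn ((1 - t) *\<^sub>R x + t *\<^sub>R p) \<noteq> x" if t: "0 < t" "t \<le> 1" for t
    proof
      assume "sgn ((1 - t) *\<^sub>R x + t *\<^sub>R p) = x"
      then have "(1 - t) *\<^sub>R x + t *\<^sub>R p = norm ((1 - t) *\<^sub>R x + t *\<^sub>R p) *\<^sub>R x"
        by (metis (no_types) norm_eq_zero right_inverse scaleR_one scaleR_scaleR scale_zero_left
            sgn_div_norm sgn_zero_iff)
      then have "t *\<^sub>R p = (norm ((1 - t) *\<^sub>R x + t *\<^sub>R p) - (1 - t)) *\<^sub>R x"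
        by (simp add: algebra_simps)
      then have "(1 / t) *\<^sub>R (t *\<^sub>R p)
          = (1 / t) *\<^sub>R ((norm ((1 - t) *\<^sub>R x + t *\<^sub>R p) - (1 - t)) *\<^sub>R x)" by simp
      then obtain c where c: "p = c *\<^sub>R x" using t by auto
      then have "\<bar>c\<bar> = 1" using assms by simp
      then show False using c i by (auto simp: abs_if split: if_splits) 
    qed
    moreover have "{0..1::real} = insert 0 {0<..1}" by auto
    ultimately show ?thesis unfolding sarc_def using sx by auto
  qed
  moreover have "connected ((\<lambda>t. sgn ((1 - t) *\<^sub>R x + t *\<^sub>R p)) ` {0<..1})"
  proof (intro connected_continuous_image c)
    show "{0<..1} \<subseteq> {0..1::real}" by auto
  qed simp
  ultimately show "connected (sarc x p - {x})" by simp
qed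

text \<open>The part of a common point \<open>v\<close> orthogonal to \<open>x\<close> is both
  \<open>t *\<^sub>R ?P\<close> and \<open>t' *\<^sub>R ?P'\<close>. Equal distances from
  \<open>x\<close> give \<open>?P\<close> and \<open>?P'\<close> the same nonzero length, so
  \<open>t = t'\<close>; as \<open>p\<close> and \<open>p'\<close> differ, this factor is 0 and
  \<open>v\<close> is \<open>x\<close>.\<close>

lemma sarc_Int:
  assumes x: "x \<in> S2" and p: "p \<in> S2" "p' \<in> S2" "p \<noteq> p'" "dist x p = r" "dist x p' = r" "0 < r" "r < 2"
  shows "sarc x p \<inter> sarc x p' = {x}"
proof -
  have i: "p \<noteq> - x" "p' \<noteq> - x" using dist_between_inner x p by blast+
  have d: "x \<bullet> p = x \<bullet> p'" using sphere_norm_dist(1)[OF x p(1)] sphere_norm_dist(1)[OF x p(2)] p(4,5) by simp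
  have d1: "(x \<bullet> p)\<^sup>2 < 1" using dist_between_inner[OF x p(1)] p by (simp add: abs_square_less_1 abs_less_iff)
  have xx: "x \<bullet> x = 1" "p \<bullet> p = 1" "p' \<bullet> p' = 1" using x p by (auto simp: norm_eq_1)
  have "v = x" if v: "v \<in> sarc x p" "v \<in> sarc x p'" for v
  proof -
    obtain s t where st: "0 \<le> s" "0 \<le> t" "v = s *\<^sub>R x + t *\<^sub>R p" "v \<in> S2"
      using sarc_decomp[OF x p(1) i(1) v(1)] by blast
    obtain s' t' where st': "0 \<le> s'" "0 \<le> t'" "v = s' *\<^sub>R x + t' *\<^sub>R p'"
      by (rule sarc_decomp[OF x p(2) i(2) v(2)])
    let ?P = "p - (x \<bullet> p) *\<^sub>R x" and ?P' = "p' - (x \<bullet> p) *\<^sub>R x"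
    have "v - (x \<bullet> v) *\<^sub>R x = t *\<^sub>R ?P" unfolding st(3) by (simp add: inner_add xx algebra_simps)
    moreover have "v - (x \<bullet> v) *\<^sub>R x = t' *\<^sub>R ?P'" unfolding st'(3) using d by (simp add: inner_add xx algebra_simps)
    ultimately have e: "t *\<^sub>R ?P = t' *\<^sub>R ?P'" by simp
    have n: "(norm ?P)\<^sup>2 = 1 - (x \<bullet> p)\<^sup>2" "(norm ?P')\<^sup>2 = 1 - (x \<bullet> p)\<^sup>2"
      unfolding power2_norm_eq_inner
      using d by (simp_all add: inner_diff xx inner_commute power2_eq_square algebra_simps)
    have "(norm ?P)\<^sup>2 > 0" using n(1) d1 by simp
    then have pos: "norm ?P > 0" by (simp only: zero_less_power2 norm_ge_zero order_less_le) auto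
    have "norm ?P = norm ?P'" using n by (metis norm_ge_zero power2_eq_imp_eq)
    moreover have "t * norm ?P = t' * norm ?P'" using arg_cong[OF e, of norm] st st' by simp
    ultimately have "t = t'" using pos by simp
    then have "t = 0" using e p(3) by auto
    then have v: "v = s *\<^sub>R x" using st by simp
    moreover have "norm v = 1" using st(4) by simp
    ultimately have "s = 1" using st(1) x by simp
    then show ?thesis using v by simp
  qed
  moreover have "x \<in> sarc x p" "x \<in> sarc x p'" using sarc(3)[OF x p(1)] sarc(3)[OF x p(2)] p by simp_all
  ultimately show ?thesis by blast
qed

text \<open>The cap is star-shaped about \<open>x\<close> along great-circle arcs;
  \<open>r \<le> 2\<close> excludes the antipode, where \<open>sarc\<close> degenerates.\<close>

lemma connected_cap:
  assumes x: "x \<in> S2" and "r \<le> 2"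
  shows "connected (S2 \<inter> ball x r)"
proof (cases "r \<le> 0")
  case True
  then have "ball x r = {}" by simp
  then show ?thesis by (simp only: Int_empty_right connected_empty)
next
  case False
  have "connected_component (S2 \<inter> ball x r) x y" if y: "y \<in> S2 \<inter> ball x r" for y
  proof (cases "y = x")
    case True
    then show ?thesis using y by (simp add: connected_component_refl_eq)
  next
    case False
    have d: "0 < dist x y" "dist x y < 2" "dist x y < r" "y \<in> S2" using y False assms by auto
    have "sarc x y \<subseteq> S2 \<inter> ball x r"
      using sarc(5,6)[OF x d(4,1,2)] subset_ball[of "dist x y" r x] d(3) y by force
    then show ?thesis
      using sarc(2-4)[OF x d(4,1,2)] unfolding connected_component_def by blast
  qed
  then show ?thesis
    unfolding connected_iff_connected_component by (meson connected_component_sym connected_component_trans)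
qed

text \<open>By Thales, the squared distances to \<open>x\<close> and \<open>- x\<close> add up to 4,
  so the complement is the open cap about \<open>- x\<close> of radius
  \<open>sqrt (4 - r\<^sup>2)\<close>.\<close>

lemma connected_cap_complement:
  assumes x: "x \<in> S2" and r: "0 \<le> r" "r \<le> 2"
  shows "connected (S2 - cball x r)"
proof -
  have "r < dist x y \<longleftrightarrow> dist (- x) y < sqrt (4 - r\<^sup>2)" if "y \<in> S2" for y
  proof -
    have "r < dist x y \<longleftrightarrow> r\<^sup>2 < (dist x y)\<^sup>2"
      using r(1) by (meson power2_less_imp_less power_strict_mono pos2 zero_le_dist)
    then show ?thesis using dist_antipode[OF x that] by simp
  qed
  then have "S2 - cball x r = S2 \<inter> ball (- x) (sqrt (4 - r\<^sup>2))"
    by (intro set_eqI) (metis Diff_iff Int_iff linorder_not_le mem_ball mem_cball)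
  moreover have "sqrt (4 - r\<^sup>2) \<le> 2" by (simp add: real_le_lsqrt)
  ultimately show ?thesis using connected_cap[of "- x"] x by simp
qed

text \<open>The arc from \<open>- x\<close> to \<open>y\<close> approaches \<open>y\<close> through
  points closer to \<open>- x\<close>, that is, farther from \<open>x\<close>.\<close>

lemma cap_boundary_in_closure:
  assumes x: "x \<in> S2" and y: "y \<in> S2" and r: "dist x y = r" "0 < r" "r < 2"
  shows "y \<in> closure (S2 - cball x r)"
proof -
  have mx: "- x \<in> S2" using x by simp
  have "dist (- x) y = sqrt (4 - r\<^sup>2)" using dist_antipode[OF x y] r by simp
  moreover have "0 < r\<^sup>2" "r\<^sup>2 < 2\<^sup>2" using r power_strict_mono[of r 2 2] by simp_all
  ultimately have d: "0 < dist (- x) y" "dist (- x) y < 2"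
    by (auto intro!: real_less_lsqrt)
  note S = sarc[OF mx y d]
  have "y islimpt sarc (- x) y"
    using S(2,3,4) d(1) by (intro connected_imp_perfect) auto
  then have "y \<in> closure (sarc (- x) y - {y})" by (simp add: islimpt_in_closure)
  moreover have "sarc (- x) y - {y} \<subseteq> S2 - cball x r"
  proof
    fix v assume v: "v \<in> sarc (- x) y - {y}"
    then have vS: "v \<in> S2" using S(5) by blast
    have "dist (- x) v < dist (- x) y" using v S(6) by auto
    then have "(- x) \<bullet> y < (- x) \<bullet> v" using dist_sphere_less_iff mx y vS by blast
    then have "x \<bullet> v < x \<bullet> y" by simp
    then have "dist x y < dist x v" using dist_sphere_less_iff x y vS by blast
    then show "v \<in> S2 - cball x r" using r vS by simp
  qed
  ultimately show ?thesis using closure_mono by blast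
qed


subsection \<open>Continua crossing between two caps\<close>

lemma sphere_point_nbhd_connected:
  assumes "y \<in> S2" "y \<notin> T" "closed T"
  obtains d where "d > 0" "\<And>q. q \<in> S2 \<inter> ball y d \<Longrightarrow> connected_component (S2 - T) y q"
proof -
  obtain e where e: "e > 0" "ball y e \<subseteq> - T"
    using assms openE[of "- T" y] by (metis ComplI open_Compl)
  \<comment> \<open>The bound 2 is the one in \<open>connected_cap\<close>.\<close>
  let ?d = "min e 2"
  have "connected (S2 \<inter> ball y ?d)" using assms by (intro connected_cap) auto
  moreover have "S2 \<inter> ball y ?d \<subseteq> S2 - T" using e by auto
  moreover have "y \<in> S2 \<inter> ball y ?d" using assms e by auto
  ultimately show thesis using e that[of ?d] unfolding connected_component_def by (metis min_less_iff_conj zero_less_numeral)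
qed

text \<open>This is non-planarity of the complete bipartite graph on 3 + 3 vertices: extending the continua
  by great-circle arcs to \<open>x\<close> and \<open>z\<close> gives three edges of a theta graph, and the third pole is a
  connected set \<open>D\<close> on the far side of \<open>J\<close> that accumulates at every point of \<open>\<alpha>\<close>.\<close>
lemma no_three_continua:
  assumes J: "simple_closed_curve J" and \<alpha>: "\<alpha> \<subseteq> J" "connected \<alpha>" "connected (J - \<alpha>)" "compact (J - \<alpha>)"
    and xz: "x \<in> S2" "z \<in> S2" and r: "0 < r" "r < 2" and disj: "cball x r \<inter> cball z r = {}"
    and \<alpha>_caps: "\<alpha> \<inter> cball x r = {}" "\<alpha> \<inter> cball z r = {}"
    and U: "connected U" "U \<subseteq> S2 - J"
    and I: "card I = 3"
    and Q: "\<And>n. n \<in> I \<Longrightarrow> compact (Q n)" "\<And>n. n \<in> I \<Longrightarrow> connected (Q n)"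
      "\<And>n. n \<in> I \<Longrightarrow> Q n \<subseteq> closure U" "\<And>n. n \<in> I \<Longrightarrow> Q n \<inter> ball x r = {}"
      "\<And>n. n \<in> I \<Longrightarrow> Q n \<inter> ball z r = {}" "\<And>n. n \<in> I \<Longrightarrow> Q n \<inter> sphere x r \<noteq> {}"
      "\<And>n. n \<in> I \<Longrightarrow> Q n \<inter> sphere z r \<noteq> {}" "\<And>n. n \<in> I \<Longrightarrow> Q n \<inter> \<alpha> \<noteq> {}"
    and Qdisj: "\<And>m n. m \<in> I \<Longrightarrow> n \<in> I \<Longrightarrow> m \<noteq> n \<Longrightarrow> Q m \<inter> Q n = {}"
  shows False
proof -
  have JS: "compact J" "J \<subseteq> S2" using simple_closed_curve_compact J by blast+
  have "closure U \<subseteq> S2" using U by (intro closure_minimal) auto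
  then have QS: "Q n \<subseteq> S2" if "n \<in> I" for n using Q(3) that by blast
  obtain a where a: "a n \<in> Q n" "dist x (a n) = r" if "n \<in> I" for n
  proof -
    have "\<forall>n\<in>I. \<exists>y. y \<in> Q n \<and> dist x y = r" using Q(6) by fastforce
    then show thesis using that by (auto dest!: bchoice)
  qed
  obtain b where b: "b n \<in> Q n" "dist z (b n) = r" if "n \<in> I" for n
  proof -
    have "\<forall>n\<in>I. \<exists>y. y \<in> Q n \<and> dist z y = r" using Q(7) by fastforce
    then show thesis using that by (auto dest!: bchoice)
  qed
  obtain w where w: "w n \<in> Q n" "w n \<in> \<alpha>" if "n \<in> I" for n
  proof -
    have "\<forall>n\<in>I. \<exists>y. y \<in> Q n \<and> y \<in> \<alpha>" using Q(8) by fastforce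
    then show thesis using that by (auto dest!: bchoice)
  qed
  have aS: "a n \<in> S2" and bS: "b n \<in> S2" if "n \<in> I" for n using a b QS that by blast+
  have sa: "compact (sarc x (a n))" "connected (sarc x (a n))" "x \<in> sarc x (a n)" "a n \<in> sarc x (a n)"
    "sarc x (a n) \<subseteq> S2" "sarc x (a n) - {a n} \<subseteq> ball x r" "connected (sarc x (a n) - {x})" if "n \<in> I" for n
    using sarc[OF xz(1) aS[OF that]] a(2)[OF that] r by auto
  have sb: "compact (sarc z (b n))" "connected (sarc z (b n))" "z \<in> sarc z (b n)" "b n \<in> sarc z (b n)"
    "sarc z (b n) \<subseteq> S2" "sarc z (b n) - {b n} \<subseteq> ball z r" "connected (sarc z (b n) - {z})" if "n \<in> I" for n
    using sarc[OF xz(2) bS[OF that]] b(2)[OF that] r by auto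
  have saX: "sarc x (a n) \<subseteq> cball x r" if "n \<in> I" for n
    using sa(6)[OF that] a(2)[OF that] by force
  have sbZ: "sarc z (b n) \<subseteq> cball z r" if "n \<in> I" for n
    using sb(6)[OF that] b(2)[OF that] by force
  have xQ: "x \<notin> Q n" "z \<notin> Q n" if "n \<in> I" for n using Q(4,5)[OF that] r by auto
  have xnz: "x \<notin> cball z r" "z \<notin> cball x r" "x \<noteq> z" proof -
    have "x \<in> cball x r" "z \<in> cball z r" using r by auto
    then show "x \<notin> cball z r" "z \<notin> cball x r" "x \<noteq> z" using disj by blast+
  qed
  have xna: "x \<noteq> a n" "z \<noteq> b n" if "n \<in> I" for n using a(2) b(2) r that by fastforce+
  \<comment> \<open>The edges of the theta graph, with poles \<open>x\<close> and \<open>z\<close>: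
    each continuum gets one arc at either end.\<close>
  define C where "C n = Q n \<union> sarc x (a n) \<union> sarc z (b n)" for n
  have Cc: "compact (C n)" "connected (C n)" "C n \<subseteq> S2" if "n \<in> I" for n
  proof -
    show "compact (C n)" unfolding C_def using Q(1) sa(1) sb(1) that by blast
    show "C n \<subseteq> S2" unfolding C_def using QS sa(5) sb(5) that by blast
    show "connected (C n)" unfolding C_def
      using Q(2) sa(2,4) sb(2,4) a(1) b(1) that by (intro connected_Un) blast+
  qed
  \<comment> \<open>Without its poles an edge is still connected, so reaching one such point of it
    from \<open>p\<close> will reach the rest.\<close>
  have Cc': "connected (C n - {x, z})" if n: "n \<in> I" for n
  proof -
    have "C n - {x, z} = Q n \<union> (sarc x (a n) - {x}) \<union> (sarc z (b n) - {z})"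
      unfolding C_def using xQ[OF n] xnz saX[OF n] sbZ[OF n] by blast
    moreover have "connected (Q n \<union> (sarc x (a n) - {x}))"
      using Q(2) sa(4,7) a(1) xna n by (intro connected_Un) blast+
    then have "connected (Q n \<union> (sarc x (a n) - {x}) \<union> (sarc z (b n) - {z}))"
    proof (rule connected_Un[OF _ sb(7)[OF n]])
      show "(Q n \<union> (sarc x (a n) - {x})) \<inter> (sarc z (b n) - {z}) \<noteq> {}"
        using sb(4)[OF n] b(1)[OF n] xna(2)[OF n] by blast
    qed
    ultimately show ?thesis by simp
  qed
  have C_int: "C m \<inter> C n = {x, z}" if mn: "m \<in> I" "n \<in> I" "m \<noteq> n" for m n
  proof -
    have 1: "Q m \<inter> Q n = {}" using Qdisj mn by blast
    have 2: "Q k \<inter> sarc x (a l) = {}" "Q k \<inter> sarc z (b l) = {}" if "k \<in> I" "l \<in> I" "k \<noteq> l" for k l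
      using Qdisj[OF that] Q(4,5)[OF that(1)] sa(6)[OF that(2)] sb(6)[OF that(2)]
        a(1)[OF that(2)] b(1)[OF that(2)] by blast+
    have 3: "sarc x (a k) \<inter> sarc z (b l) = {}" if "k \<in> I" "l \<in> I" for k l
      using saX[OF that(1)] sbZ[OF that(2)] disj by blast
    have "a m \<noteq> a n" "b m \<noteq> b n" using a(1) b(1) 1 mn by (metis disjoint_iff)+
    then have 4: "sarc x (a m) \<inter> sarc x (a n) = {x}" "sarc z (b m) \<inter> sarc z (b n) = {z}"
      using sarc_Int[OF xz(1) aS aS] sarc_Int[OF xz(2) bS bS] a(2) b(2) r mn by simp_all
    show ?thesis unfolding C_def using 1
      unfolding Int_Un_distrib Int_Un_distrib2 1 2[OF mn] 3[OF mn(1,2)] 4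
        Int_commute[of _ "Q n"] Int_commute[of "sarc z (b m)" "sarc x (a n)"]
        2[OF mn(2,1) mn(3)[symmetric]] 3[OF mn(2,1)] by auto
  qed
  define X where "X = S2 \<inter> cball x r"
  define Z where "Z = S2 \<inter> cball z r"
  \<comment> \<open>\<open>T\<close> gathers the rest of \<open>J\<close> and both closed caps. It
    is disjoint from \<alpha>, and \<open>J \<inter> T\<close> is the connected set
    \<open>J - \<alpha>\<close>.\<close>
  define T where "T = (J - \<alpha>) \<union> X \<union> Z"
  have cXZ: "compact X" "compact Z" unfolding X_def Z_def by (simp_all add: compact_Int)
  have cT: "compact T" "closed T" "T \<subseteq> S2"
    using \<alpha>(4) cXZ JS unfolding T_def X_def Z_def by (auto intro!: compact_imp_closed)
  have \<alpha>T: "\<alpha> \<subseteq> S2 - T" using \<alpha>_caps \<alpha>(1) JS unfolding T_def X_def Z_def by blast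
  obtain l where l: "l \<in> I" using I by fastforce
  obtain u where u: "u \<in> U" using Q(3)[OF l] w(1)[OF l] by (metis closure_empty empty_iff equals0I subsetD)
  obtain d where d: "d > 0" "\<And>q. q \<in> S2 \<inter> ball (w l) d \<Longrightarrow> connected_component (S2 - T) (w l) q"
    using sphere_point_nbhd_connected[of "w l" T] \<alpha>T w(2)[OF l] cT by blast
  \<comment> \<open>Jordan's theorem supplies \<open>p\<close> next to \<open>w l\<close>, across
    \<open>J\<close> from \<open>U\<close>.\<close>
  obtain p where p: "p \<in> ball (w l) d" "p \<in> S2" "p \<notin> J" "\<not> connected_component (S2 - J) u p"
  proof -
    have "u \<in> S2 - J" "w l \<in> J" "w l \<in> ball (w l) d" using u U w(2)[OF l] \<alpha>(1) d(1) by auto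
    then show thesis
      using simple_closed_curve_both_sides(2)[OF J _ _ open_ball] that by blast
  qed
  have p\<alpha>: "connected_component (S2 - T) p y" if "y \<in> \<alpha>" for y
  proof -
    have "connected_component (S2 - T) (w l) p" using d(2) p by blast
    moreover have "connected_component (S2 - T) (w l) y"
      using \<alpha>(2) \<alpha>T w(2)[OF l] that unfolding connected_component_def by blast
    ultimately show ?thesis by (meson connected_component_sym connected_component_trans)
  qed
  define D where "D = connected_component_set (S2 - (J \<union> T)) p"
  \<comment> \<open>A point \<open>q\<close> near \<open>y\<close> is chosen on the side of
    \<open>p\<close>, hence joined to \<open>p\<close> off \<open>J\<close>. It is joined to
    \<open>p\<close> off \<open>T\<close> too, by way of \<alpha>. Since \<open>J \<inter> T\<close>
    is connected, Janiszewski combines the two and \<open>q\<close> is in \<open>D\<close>.\<close>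
  have D_near: "\<exists>q \<in> V. q \<in> D" if y: "y \<in> \<alpha>" and V: "open V" "y \<in> V" for y V
  proof -
    obtain d where d: "d > 0" "\<And>q. q \<in> S2 \<inter> ball y d \<Longrightarrow> connected_component (S2 - T) y q"
      using sphere_point_nbhd_connected[of y T] \<alpha>T y cT by blast
    obtain q where q: "q \<in> V" "q \<in> ball y d" "connected_component (S2 - J) p q"
    proof -
      have "p \<in> S2 - J" "y \<in> J" "y \<in> V \<inter> ball y d" "open (V \<inter> ball y d)"
        using p y \<alpha>(1) V d(1) by auto
      then show thesis
        using simple_closed_curve_both_sides(1)[OF J, of p y "V \<inter> ball y d"] that by blast
    qed
    have "q \<in> S2" using q(3) connected_component_in by fast
    then have "connected_component (S2 - T) p q"
      using d(2)[of q] q(2) p\<alpha>[OF y] connected_component_trans by fast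
    moreover have "J \<inter> T = J - \<alpha>" using \<alpha>T cT \<alpha>(1) unfolding T_def by blast
    ultimately have "connected_component (S2 - (J \<union> T)) p q"
      using sphere_Janiszewski[of J T p q] JS cT q(3) \<alpha>(3) by simp
    then show ?thesis using q(1) unfolding D_def by blast
  qed
  \<comment> \<open>The component of \<open>p\<close> off \<open>J\<close> is open in the sphere and
    misses \<open>U\<close>, hence misses its closure as well.\<close>
  have DU: "D \<inter> closure U = {}"
  proof -
    define D' where "D' = connected_component_set (S2 - J) p"
    have "D \<subseteq> D'" unfolding D_def D'_def by (rule connected_component_mono) blast
    have "openin (top_of_set S2) (S2 - J)"
      using JS by (metis closed_closedin compact_imp_closed Diff_eq open_Compl openin_open_Int)
    moreover have "locally connected S2" by (rule locally_connected_sphere)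
    ultimately have "openin (top_of_set S2) D'" unfolding D'_def
      using p by (simp add: locally_connected_open_connected_component)
    then obtain W where W: "open W" "D' = S2 \<inter> W" unfolding openin_open by blast
    have "U \<inter> D' = {}"
    proof (rule ccontr)
      assume "U \<inter> D' \<noteq> {}"
      then obtain v where v: "v \<in> U" "connected_component (S2 - J) p v" unfolding D'_def by blast
      moreover have "connected_component (S2 - J) u v"
        using U u v unfolding connected_component_def by blast
      ultimately show False using p(4) by (meson connected_component_sym connected_component_trans)
    qed
    then have "W \<inter> U = {}" using W U by blast
    then have "W \<inter> closure U = {}" using W(1) open_Int_closure_eq_empty by blast
    then show ?thesis using \<open>D \<subseteq> D'\<close> W by blast
  qed
  have DC: "D \<inter> C n = {}" if "n \<in> I" for n
  proof -
    have "D \<inter> T = {}" unfolding D_def using connected_component_subset[of "S2 - (J \<union> T)" p] by blast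
    moreover have "sarc x (a n) \<subseteq> T" "sarc z (b n) \<subseteq> T"
      unfolding T_def X_def Z_def using saX sbZ sa(5) sb(5) that by blast+
    ultimately show ?thesis unfolding C_def using DU Q(3)[OF that] by blast
  qed
  have pD: "p \<in> D"
    using D_near[OF w(2)[OF l], of UNIV] connected_component_in unfolding D_def
    by (metis (no_types, lifting) UNIV_I connected_component_refl mem_Collect_eq open_UNIV)
  have DS: "D \<subseteq> S2" "connected D" unfolding D_def using connected_component_subset by fastforce+
  \<comment> \<open>From \<open>p\<close> one moves within \<open>D\<close>, which meets no edge, up
    to a point near \<open>w k\<close>, then to \<open>w k\<close>, and finally along the edge
    \<open>C k\<close> without its poles.\<close>
  have out: "C k \<subseteq> {x, z} \<union> connected_component_set (S2 - (C m \<union> C n)) p"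
    if k: "k \<in> I" "m \<in> I" "n \<in> I" "k \<noteq> m" "k \<noteq> n" for k m n
  proof -
    have wk: "w k \<notin> C m \<union> C n" "w k \<in> S2" "w k \<notin> {x, z}" "w k \<in> C k"
    proof -
      have "w k \<notin> sarc x (a i)" "w k \<notin> sarc z (b i)" if "i \<in> I" for i
        using w(2)[OF k(1)] \<alpha>_caps saX[OF that] sbZ[OF that] by blast+
      then show "w k \<notin> C m \<union> C n" using w(1)[OF k(1)] Qdisj[of k] k unfolding C_def by blast
      show "w k \<in> S2" "w k \<notin> {x, z}" "w k \<in> C k"
        using w(1)[OF k(1)] QS[OF k(1)] xQ[OF k(1)] unfolding C_def by auto
    qed
    have cl: "closed (C m \<union> C n)" using Cc k compact_imp_closed by blast
    obtain d where d: "d > 0" "\<And>q. q \<in> S2 \<inter> ball (w k) d \<Longrightarrow> connected_component (S2 - (C m \<union> C n)) (w k) q"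
      using sphere_point_nbhd_connected[OF wk(2,1) cl] by blast
    obtain q where q: "q \<in> ball (w k) d" "q \<in> D" using D_near[OF w(2)[OF k(1)], of "ball (w k) d"] d(1) by auto
    have "connected_component (S2 - (C m \<union> C n)) p q"
      using pD q(2) DS DC[OF k(2)] DC[OF k(3)] unfolding connected_component_def by blast
    moreover have "connected_component (S2 - (C m \<union> C n)) (w k) q" using d(2) q DS(1) by blast
    ultimately have pw: "connected_component (S2 - (C m \<union> C n)) p (w k)"
      by (meson connected_component_sym connected_component_trans)
    have "C k - {x, z} \<subseteq> S2 - (C m \<union> C n)"
      using C_int[OF k(1,2,4)] C_int[OF k(1,3,5)] Cc(3)[OF k(1)] by blast
    then have "connected_component (S2 - (C m \<union> C n)) (w k) y" if "y \<in> C k - {x, z}" for y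
      using Cc'[OF k(1)] that wk unfolding connected_component_def by blast
    then show ?thesis using pw connected_component_trans by fast
  qed
  obtain i j k where ijk: "i \<in> I" "j \<in> I" "k \<in> I" "i \<noteq> j" "i \<noteq> k" "j \<noteq> k"
    using I by (auto simp: card_3_iff)
  show False
  proof (rule sphere_theta[of "C i" "C j" "C k" p x z])
    show "p \<in> S2 - (C i \<union> C j \<union> C k)" using pD DC ijk p(2) by blast
    show "C i \<inter> C j = {x, z}" "C i \<inter> C k = {x, z}" "C j \<inter> C k = {x, z}"
      using C_int ijk by blast+
  qed (use Cc out ijk xnz in auto)
qed


text \<open>Boundary bumping: if no component joined the two spheres,
  \<open>cut_wire_fence_theorem\<close> would split the trimmed set into two closed parts, one
  holding its points on each sphere. Adding to each the part of \<open>P\<close> in the respective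
  closed ball would disconnect \<open>P\<close>.\<close>

lemma crossing_component:
  fixes x z :: "'a::euclidean_space"
  assumes P: "compact P" "connected P" and disj: "cball x r \<inter> cball z r = {}"
    and meet: "P \<inter> cball x r \<noteq> {}" "P \<inter> cball z r \<noteq> {}"
  obtains Q where "Q \<in> components (P - (ball x r \<union> ball z r))"
    "Q \<inter> sphere x r \<noteq> {}" "Q \<inter> sphere z r \<noteq> {}"
proof (rule ccontr)
  note obt = that
  assume no: "\<not> thesis"
  let ?M = "P - (ball x r \<union> ball z r)"
  have cM: "compact ?M" using P(1) by (intro compact_diff open_Un open_ball)
  have "separated_between (top_of_set ?M) (?M \<inter> sphere x r) (?M \<inter> sphere z r)"
  proof (rule cut_wire_fence_theorem)
    show "compact_space (top_of_set ?M)" using cM by (simp add: compact_space_subtopology)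
    show "Hausdorff_space (top_of_set ?M)" by (simp add: Hausdorff_space_subtopology)
    show "closedin (top_of_set ?M) (?M \<inter> sphere x r)" "closedin (top_of_set ?M) (?M \<inter> sphere z r)"
      by (auto intro: closedin_closed_Int)
    show "disjnt C (?M \<inter> sphere x r) \<or> disjnt C (?M \<inter> sphere z r)"
      if C: "connectedin (top_of_set ?M) C" for C
    proof (rule ccontr)
      assume *: "\<not> ?thesis"
      then obtain y where y: "y \<in> C" unfolding disjnt_def by blast
      have C': "connected C" "C \<subseteq> ?M" using C by (auto simp: connectedin_subtopology)
      then have sub: "C \<subseteq> connected_component_set ?M y" using y by (simp add: connected_component_maximal)
      moreover have "connected_component_set ?M y \<in> components ?M" using y C' by (auto simp: components_def)
      moreover have "connected_component_set ?M y \<inter> sphere x r \<noteq> {}"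
        "connected_component_set ?M y \<inter> sphere z r \<noteq> {}"
        using sub * unfolding disjnt_def by blast+
      ultimately show False using obt no by blast
    qed
  qed
  then obtain E where E: "closedin (top_of_set ?M) E" "openin (top_of_set ?M) E"
      "?M \<inter> sphere x r \<subseteq> E" "?M \<inter> sphere z r \<subseteq> ?M - E"
    unfolding separated_between by auto
  have cl: "closed E" "closed (?M - E)"
    using E(1,2) closedin_closed_trans[OF _ compact_imp_closed[OF cM]] 
    by (auto simp: closedin_diff)
  have EM: "E \<subseteq> ?M" using E(1) closedin_imp_subset by blast
  let ?A = "E \<union> (P \<inter> cball x r)" and ?B = "(?M - E) \<union> (P \<inter> cball z r)"
  have "closed ?A" "closed ?B" by (intro closed_Un closed_Int closed_cball cl compact_imp_closed[OF P(1)])+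
  moreover have "P \<subseteq> ?A \<union> ?B" using ball_subset_cball by blast
  moreover have "?A \<inter> ?B = {}"
  proof -
    have "E \<inter> (P \<inter> cball z r) = {}"
      using EM E(4) by (auto simp: cball_diff_sphere[symmetric] sphere_cball)
    moreover have "(P \<inter> cball x r) \<inter> (?M - E) = {}"
      using E(3) by auto
    moreover have "(P \<inter> cball x r) \<inter> (P \<inter> cball z r) = {}" using disj by blast
    ultimately show ?thesis by blast
  qed
  ultimately show False
    using connected_closedD[OF P(2), of ?A ?B] meet by blast
qed

section \<open>Subarcs of closed curves, and round circles\<close>

text \<open>After a shift of the parameter that puts \<open>w\<close> at 1/2, the arc is the image
  of a short interval about 1/2. The rest is the image of two end intervals, joined at the base
  point of the loop, and \<open>V\<close> is the complement of this compact rest.\<close>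

lemma simple_closed_curve_small_arc:
  assumes J: "simple_closed_curve J" and w: "w \<in> J" and N: "open N" "w \<in> N"
  obtains V where "open V" "w \<in> V" "J \<inter> V \<subseteq> N" "connected (J \<inter> V)" "connected (J - J \<inter> V)" "compact (J - J \<inter> V)"
proof -
  obtain g0 where g0: "simple_path g0" "pathfinish g0 = pathstart g0" "path_image g0 = J"
    using J unfolding simple_closed_curve_def by blast
  obtain s where s: "0 \<le> s" "s \<le> 1" "w = g0 s" using w g0(3) unfolding path_image_def by auto
  \<comment> \<open>Half a period away from \<open>s\<close>, modulo 1, so that the shifted loop is
    at \<open>w\<close> at parameter 1/2.\<close>
  define c where "c = (if s \<ge> 1/2 then s - 1/2 else s + 1/2)"
  define g where "g = shiftpath c g0"
  have c01: "0 \<le> c" "c \<le> 1" using s unfolding c_def by (auto split: if_splits)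
  have g: "simple_path g" "pathfinish g = pathstart g" "path_image g = J"
    unfolding g_def using c01
    by (simp_all add: simple_path_shiftpath closed_shiftpath path_image_shiftpath g0)
  have g_half: "g (1/2) = w"
    using s g0(2) unfolding g_def shiftpath_def c_def pathfinish_def pathstart_def
    by (auto split: if_splits)
  have cg: "continuous_on {0..1} g" using g(1) by (simp add: simple_path_def path_def)
  have "openin (top_of_set {0..1}) ({0..1} \<inter> g -` N)" using cg N(1) by (simp add: continuous_openin_preimage_gen)
  then obtain W where W: "open W" "{0..1} \<inter> g -` N = {0..1} \<inter> W" unfolding openin_open by blast
  have "(1/2::real) \<in> {0..1} \<inter> g -` N" using g_half N(2) by simp
  then have "(1/2::real) \<in> W" unfolding W(2) by blast
  then obtain e where e: "e > 0" "ball (1/2) e \<subseteq> W" using W(1) openE by blast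
  \<comment> \<open>At most 1/4, so that the interval stays off 0 and 1, the only two parameters
    that the loop identifies.\<close>
  define d where "d = min e (1/4)"
  have d: "0 < d" "d \<le> 1/4" "d \<le> e" unfolding d_def using e by auto
  let ?I = "{1/2 - d<..<1/2 + d}" and ?K = "{0..1/2 - d} \<union> {1/2 + d..1}"
  have I01: "?I \<subseteq> {0..1}" "?K \<subseteq> {0..1}" using d by auto
  have split: "{0..1} = ?I \<union> ?K" using d by auto
  have gI: "g ` ?I \<subseteq> N"
  proof -
    have "?I \<subseteq> {0..1} \<inter> W" using I01 d e by (auto simp: subset_iff dist_real_def abs_if)
    then have "?I \<subseteq> {0..1} \<inter> g -` N" using W(2) by simp
    then show ?thesis by blast
  qed
  have dis: "g ` ?I \<inter> g ` ?K = {}"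
  proof -
    have "g u \<noteq> g v" if u: "u \<in> ?I" and v: "v \<in> ?K" for u v
    proof
      assume "g u = g v"
      moreover have "u \<in> {0..1}" "v \<in> {0..1}" using u v I01 by blast+
      ultimately have "u = v \<or> u = 0 \<and> v = 1 \<or> u = 1 \<and> v = 0"
        using g(1) unfolding simple_path_def loop_free_def by blast
      then show False using u v d by auto
    qed
    then show ?thesis by blast
  qed
  have J_eq: "J = g ` ?I \<union> g ` ?K"
    using g(3) split unfolding path_image_def by (metis image_Un)
  have ccK: "compact (g ` ?K)" using cg I01 by (intro compact_continuous_image continuous_on_subset[OF cg]) auto
  define V where "V = - g ` ?K"
  have JV: "J \<inter> V = g ` ?I" "J - J \<inter> V = g ` ?K" unfolding V_def using J_eq dis by blast+
  show thesis
  proof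
    show "open V" unfolding V_def using ccK by (simp add: compact_imp_closed open_Compl)
    have "w \<in> g ` ?I" using g_half d by (metis add_less_same_cancel1 diff_less_eq greaterThanLessThan_iff image_eqI less_add_same_cancel1)
    then show "w \<in> V" using JV by blast
    show "J \<inter> V \<subseteq> N" using JV gI by simp
    show "connected (J \<inter> V)" unfolding JV using cg I01
      by (intro connected_continuous_image continuous_on_subset[OF cg]) auto
    show "compact (J - J \<inter> V)" unfolding JV(2) by (rule ccK)
    have "connected (g ` {0..1/2 - d})" "connected (g ` {1/2 + d..1})"
      using d by (intro connected_continuous_image continuous_on_subset[OF cg]; auto)+
    moreover have "g 0 = g 1" using g(2) by (simp add: pathfinish_def pathstart_def)
    then have "g ` {0..1/2 - d} \<inter> g ` {1/2 + d..1} \<noteq> {}"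
    proof -
      have "g 0 \<in> g ` {0..1/2 - d}" "g 1 \<in> g ` {1/2 + d..1}" using d by auto
      then show ?thesis using \<open>g 0 = g 1\<close> by auto
    qed
    ultimately show "connected (J - J \<inter> V)" unfolding JV(2) image_Un by (rule connected_Un)
  qed
qed

text \<open>The circle is a circle of latitude about the third coordinate axis, of height
  \<open>c\<close> and radius \<open>s\<close>, carried over to \<open>x\<close> by the orthogonal
  map \<open>f\<close>.\<close>

lemma simple_closed_curve_circle:
  assumes x: "x \<in> S2" and r: "0 < r" "r < 2"
  shows "simple_closed_curve (S2 \<inter> sphere x r)"
proof -
  \<comment> \<open>For \<open>y\<close> on the sphere, distance \<open>r\<close> from
    \<open>x\<close> amounts to \<open>x \<bullet> y = c\<close>.\<close>
  define c where "c = 1 - r\<^sup>2 / 2"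
  have r2: "0 < r\<^sup>2" "r\<^sup>2 < 4" using r power_strict_mono[of r 2 2] by simp_all
  have c: "-1 < c" "c < 1" unfolding c_def using r2 by auto
  define s where "s = sqrt (1 - c\<^sup>2)"
  have c2: "c\<^sup>2 < 1" using c by (simp add: abs_square_less_1 abs_less_iff)
  have s: "0 < s" "s\<^sup>2 = 1 - c\<^sup>2" unfolding s_def using c2 by auto
  obtain f :: "real^3 \<Rightarrow> real^3" where f: "orthogonal_transformation f" "f (axis 3 1) = x"
    using orthogonal_transformation_exists_1[of "axis 3 1" x] x by auto
  define G :: "real \<Rightarrow> real^3" where "G t = vector [s * cos (2 * pi * t), s * sin (2 * pi * t), c]" for t
  have Gi: "G t $ 1 = s * cos (2 * pi * t)" "G t $ 2 = s * sin (2 * pi * t)" "G t $ 3 = c" for t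
    unfolding G_def by (simp_all add: vector_3)
  have lin: "linear f" "inj f" using f(1) orthogonal_transformation_linear orthogonal_transformation_inj by blast+
  have circ: "S2 \<inter> sphere x r = {y \<in> S2. x \<bullet> y = c}"
  proof -
    have "dist x y = r \<longleftrightarrow> x \<bullet> y = c" if "y \<in> S2" for y
    proof -
      have "dist x y = r \<longleftrightarrow> (dist x y)\<^sup>2 = r\<^sup>2" using r by auto
      then show ?thesis using sphere_norm_dist(1)[OF x that] unfolding c_def by auto
    qed
    then show ?thesis by auto
  qed
  have img: "G ` {0..1} = {y \<in> S2. axis 3 1 \<bullet> y = c}"
  proof (intro equalityI subsetI)
    fix y assume "y \<in> G ` {0..1}"
    then obtain t where t: "y = G t" by blast
    have "(norm (G t))\<^sup>2 = (s * cos (2 * pi * t))\<^sup>2 + (s * sin (2 * pi * t))\<^sup>2 + c\<^sup>2"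
      unfolding power2_norm_eq_inner inner_vec_def by (simp add: sum_3 Gi power2_eq_square)
    also have "\<dots> = s\<^sup>2 * ((cos (2 * pi * t))\<^sup>2 + (sin (2 * pi * t))\<^sup>2) + c\<^sup>2" 
      by (simp only: power_mult_distrib distrib_left)
    also have "\<dots> = 1" by (simp only: sin_cos_squared_add2 s(2) mult_1_right)
    finally have "norm (G t) = 1" by (simp add: power2_eq_1_iff) (metis norm_ge_zero not_one_le_zero neg_0_le_iff_le)
    then show "y \<in> {y \<in> S2. axis 3 1 \<bullet> y = c}" using t by (simp add: Gi inner_axis')
  next
    fix y :: "real^3" assume y: "y \<in> {y \<in> S2. axis 3 1 \<bullet> y = c}"
    then have y3: "y $ 3 = c" by (simp add: inner_axis')
    have "(norm y)\<^sup>2 = (y $ 1)\<^sup>2 + (y $ 2)\<^sup>2 + (y $ 3)\<^sup>2"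
      unfolding power2_norm_eq_inner inner_vec_def by (simp add: sum_3 power2_eq_square)
    then have "(y $ 1)\<^sup>2 + (y $ 2)\<^sup>2 = s\<^sup>2" using y y3 s by simp
    then have "(y $ 1 / s)\<^sup>2 + (y $ 2 / s)\<^sup>2 = 1" 
      using s(1) by (simp only: power_divide add_divide_distrib[symmetric]) simp
    then obtain t where t: "0 \<le> t" "t < 2 * pi" "y $ 1 / s = cos t" "y $ 2 / s = sin t"
      using sincos_total_2pi by metis
    have "y = G (t / (2 * pi))"
      unfolding vec_eq_iff forall_3 Gi using t s y3 by (simp add: field_simps)
    moreover have "t / (2 * pi) \<in> {0..1}" using t by (simp add: field_simps)
    ultimately show "y \<in> G ` {0..1}" by blast
  qed
  have "path G"
  proof -
    have "continuous_on {0..1} (\<lambda>t. \<chi> i. G t $ i)"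
    proof (rule continuous_on_vec_lambda)
      fix i :: 3
      have "i = 1 \<or> i = 2 \<or> i = 3" by (rule exhaust_3)
      then show "continuous_on {0..1} (\<lambda>t. G t $ i)" 
        by (elim disjE; simp only: Gi; intro continuous_intros)
    qed
    then show ?thesis by (simp add: path_def)
  qed
  moreover have "loop_free G"
  proof -
    have "a = b \<or> a = 0 \<and> b = 1 \<or> a = 1 \<and> b = 0" if ab: "0 \<le> a" "a \<le> 1" "0 \<le> b" "b \<le> 1" "G a = G b" for a b
    proof -
      have "cos (2 * pi * a) = cos (2 * pi * b)" "sin (2 * pi * a) = sin (2 * pi * b)"
        using Gi(1,2)[of a] Gi(1,2)[of b] ab(5) s(1) by auto
      then obtain n :: int where "2 * pi * a = 2 * pi * b + 2 * pi * n"
        using sin_cos_eq_iff by metis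
      then have "2 * pi * a = 2 * pi * (b + n)" by (simp add: algebra_simps)
      then have n: "a = b + n" by simp
      then have "\<bar>real_of_int n\<bar> \<le> 1" using ab by linarith
      then have "n = 0 \<or> n = 1 \<or> n = -1" by linarith
      then show ?thesis using n ab by auto
    qed
    then show ?thesis unfolding loop_free_def by auto
  qed
  ultimately have G: "simple_path G" "pathfinish G = pathstart G"
    by (auto simp: simple_path_def pathfinish_def pathstart_def G_def)
  have "simple_path (f \<circ> G)" using G(1) lin by (simp add: simple_path_linear_image_eq)
  moreover have "pathfinish (f \<circ> G) = pathstart (f \<circ> G)" using G(2) by (simp add: pathfinish_compose pathstart_compose)
  moreover have "path_image (f \<circ> G) = S2 \<inter> sphere x r"
  proof -
    have "surj f" using lin by (simp add: linear_injective_imp_surjective)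
    have inn: "f u \<bullet> f v = u \<bullet> v" "norm (f u) = norm u" for u v
      using f(1) by (simp_all add: orthogonal_transformation_def orthogonal_transformation_norm)
    have "path_image (f \<circ> G) = f ` {y \<in> S2. axis 3 1 \<bullet> y = c}"
      by (simp only: path_image_compose path_image_def image_comp[symmetric] img)
    also have "\<dots> = {y \<in> S2. x \<bullet> y = c}"
    proof (intro equalityI subsetI)
      fix y assume y: "y \<in> {y \<in> S2. x \<bullet> y = c}"
      obtain u where u: "y = f u" using \<open>surj f\<close> by (metis surjD)
      have "norm u = 1" "axis 3 1 \<bullet> u = c" using y inn f(2) unfolding u by auto
      then show "y \<in> f ` {y \<in> S2. axis 3 1 \<bullet> y = c}" using u by auto
    next
      fix y assume "y \<in> f ` {y \<in> S2. axis 3 1 \<bullet> y = c}"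
      then show "y \<in> {y \<in> S2. x \<bullet> y = c}" using inn f(2) by (metis (mono_tags, lifting) imageE mem_Collect_eq mem_sphere_0)
    qed
    finally show ?thesis using circ by simp
  qed
  ultimately show ?thesis unfolding simple_closed_curve_def riemann_sphere_def by blast
qed


subsection \<open>Annuli between caps and Hausdorff limits\<close>

text \<open>This makes two round circles admissible as witnessing curves. The region between them is
  connected by \<open>sphere_Janiszewski\<close>, for each closed cap has a connected complement and
  the caps are disjoint.\<close>

lemma caps_annulus:
  assumes xz: "x \<in> S2" "z \<in> S2" and r: "0 < r" "r < 2" and disj: "cball x r \<inter> cball z r = {}"
  shows "closure (S2 - (cball x r \<union> cball z r)) = S2 - (ball x r \<union> ball z r)" (is "closure ?V = ?W")
    and "is_U (S2 \<inter> sphere x r) (S2 \<inter> sphere z r) (S2 - (cball x r \<union> cball z r))"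
proof -
  have cW: "compact ?W" by (intro compact_diff open_Un open_ball compact_sphere)
  have "?V \<subseteq> ?W" using ball_subset_cball by blast
  then have sub: "closure ?V \<subseteq> ?W" using cW by (simp only: closure_minimal compact_imp_closed)
  have sup: "y \<in> closure ?V" if y: "y \<in> ?W" for y
  proof -
    \<comment> \<open>A boundary point of one cap is a limit of points beyond that cap; close to it
      the other closed cap is absent.\<close>
    have near: "y \<in> closure (S2 - (cball a r \<union> cball b r))"
      if "dist a y = r" "a \<in> S2" "y \<notin> cball b r" for a b
    proof -
      have "y \<in> closure (S2 - cball a r)"
        using cap_boundary_in_closure[of a y r] that y r by blast
      then have "y \<in> closure (- cball b r \<inter> (S2 - cball a r))"
        using open_Int_closure_subset[OF open_Compl[OF closed_cball], of b r "S2 - cball a r"] that(3)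
        by blast
      moreover have "- cball b r \<inter> (S2 - cball a r) = S2 - (cball a r \<union> cball b r)" by blast
      ultimately show ?thesis by simp
    qed
    consider "dist x y = r" | "dist z y = r" | "y \<in> ?V" using y by force
    then show ?thesis
    proof cases
      case 1
      then have "y \<in> cball x r" by simp
      then have "y \<notin> cball z r" using disj by blast
      then show ?thesis using near[OF 1 xz(1)] by blast
    next
      case 2
      then have "y \<in> cball z r" by simp
      then have "y \<notin> cball x r" using disj by blast
      then show ?thesis using near[OF 2 xz(2)] unfolding Un_commute[of "cball z r"] by blast
    next
      case 3
      then show ?thesis by (rule subsetD[OF closure_subset])
    qed
  qed
  show cl: "closure ?V = ?W" by (rule subset_antisym[OF sub subsetI[OF sup]])
  have conn: "connected ?V"
    unfolding connected_iff_connected_component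
  proof (intro ballI)
    fix p q assume pq: "p \<in> ?V" "q \<in> ?V"
    have cc: "connected_component (S2 - (S2 \<inter> cball a r)) p q"
      if "a \<in> S2" "p \<notin> cball a r" "q \<notin> cball a r" for a
    proof -
      have "connected (S2 - (S2 \<inter> cball a r))"
        using connected_cap_complement[OF that(1), of r] r by (simp add: Diff_Int)
      then show ?thesis using that pq unfolding connected_component_def by blast
    qed
    have "connected_component (S2 - ((S2 \<inter> cball x r) \<union> (S2 \<inter> cball z r))) p q"
    proof (rule sphere_Janiszewski)
      have "S2 \<inter> cball x r \<inter> (S2 \<inter> cball z r) = {}" using disj by blast
      then show "connected (S2 \<inter> cball x r \<inter> (S2 \<inter> cball z r))" by (simp only: connected_empty)
      show "connected_component (S2 - (S2 \<inter> cball x r)) p q" "connected_component (S2 - (S2 \<inter> cball z r)) p q"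
        using cc xz pq by blast+
    qed (auto intro: compact_Int)
    moreover have "S2 - ((S2 \<inter> cball x r) \<union> (S2 \<inter> cball z r)) = ?V" by blast
    ultimately show "connected_component ?V p q" by simp
  qed
  have ne: "?V \<noteq> {}"
  proof
    assume "?V = {}"
    then have "?W = {}" using cl by (metis closure_empty)
    moreover obtain y where "y \<in> S2 \<inter> sphere x r"
      using simple_closed_curve_circle[OF xz(1) r] unfolding simple_closed_curve_def
      by (metis path_image_nonempty ex_in_conv)
    then have "y \<in> ?W" using disj by auto
    ultimately show False by blast
  qed
  have op: "openin (top_of_set S2) ?V"
  proof -
    have "?V = S2 \<inter> - (cball x r \<union> cball z r)" by blast
    moreover have "open (- (cball x r \<union> cball z r))" by (intro open_Compl closed_Un closed_cball)
    ultimately show ?thesis by (metis openin_open_Int)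
  qed
  have "?V \<in> components (S2 - (S2 \<inter> sphere x r \<union> S2 \<inter> sphere z r))"
    unfolding in_components_maximal
  proof (intro conjI allI impI)
    \<comment> \<open>A connected \<open>D\<close> missing both circles is covered by the region and
      the open caps, so it cannot reach into the caps.\<close>
    fix D assume D: "D \<noteq> {} \<and> ?V \<subseteq> D \<and> D \<subseteq> S2 - (S2 \<inter> sphere x r \<union> S2 \<inter> sphere z r) \<and> connected D"
    let ?A = "- (cball x r \<union> cball z r)" and ?B = "ball x r \<union> ball z r"
    have "open ?A" "open ?B" by (intro open_Compl closed_Un closed_cball open_Un open_ball)+
    moreover have "D \<subseteq> ?A \<union> ?B" using D by force
    moreover have "?A \<inter> ?B \<inter> D = {}" using ball_subset_cball by blast
    ultimately have "?A \<inter> D = {} \<or> ?B \<inter> D = {}" using connectedD[of D ?A ?B] D by blast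
    moreover have "?A \<inter> D \<noteq> {}" using D ne by blast
    ultimately have "D \<subseteq> ?A" using \<open>D \<subseteq> ?A \<union> ?B\<close> by blast
    then show "D = ?V" using D by blast
  qed (use ne conn in auto)
  moreover have "(top_of_set S2) frontier_of ?V = S2 \<inter> sphere x r \<union> S2 \<inter> sphere z r"
  proof -
    have "(top_of_set S2) frontier_of ?V = (top_of_set S2) closure_of ?V - ?V"
      using op by (rule frontier_of_openin)
    also have "(top_of_set S2) closure_of ?V = S2 \<inter> closure ?V"
      using op by (simp add: closure_of_subtopology_open closure_of_subtopology Int_absorb1)
    also have "\<dots> = ?W" using cl by blast
    also have "?W - ?V = S2 \<inter> sphere x r \<union> S2 \<inter> sphere z r"
    proof -
      have "sphere x r \<subseteq> - cball z r" "sphere z r \<subseteq> - cball x r" using disj by fastforce+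
      then show ?thesis by force
    qed
    finally show ?thesis .
  qed
  ultimately show "is_U (S2 \<inter> sphere x r) (S2 \<inter> sphere z r) ?V"
    unfolding is_U_def riemann_sphere_def by blast
qed

section \<open>Hausdorff limits of subsets of a compact set\<close>

text \<open>Blaschke's selection theorem by way of Arzela-Ascoli: the distance functions
  \<open>F n\<close> of the sets are uniformly bounded on \<open>K\<close> and 1-Lipschitz. The zero
  set of a uniform limit \<open>g\<close> of a subsequence is the limit set.\<close>

lemma hausdorff_convergent_subsequence:
  fixes P :: "nat \<Rightarrow> (real^3) set"
  assumes K: "compact K" and P: "\<And>n. P n \<subseteq> K" "\<And>n. P n \<noteq> {}"
  obtains k L where "strict_mono (k :: nat \<Rightarrow> nat)" "compact L" "L \<noteq> {}" "L \<subseteq> K" "hausdorff_converges (P \<circ> k) L"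
proof -
  define F where "F n y = infdist y (P n)" for n y
  obtain B where B: "\<And>y. y \<in> K \<Longrightarrow> norm y \<le> B" using K compact_imp_bounded bounded_iff by metis
  obtain g k where gk: "continuous_on K g" "strict_mono (k :: nat \<Rightarrow> nat)"
    "\<And>e. 0 < e \<Longrightarrow> \<exists>N. \<forall>n y. n \<ge> N \<and> y \<in> K \<longrightarrow> norm (F (k n) y - g y) < e"
  proof (rule Arzela_Ascoli[OF K, of F "2 * B"])
    fix n y assume y: "y \<in> K"
    obtain p where p: "p \<in> P n" using P(2) by blast
    have "F n y \<le> dist y p" unfolding F_def using p by (rule infdist_le)
    also have "\<dots> \<le> norm y + norm p" by (simp add: dist_norm norm_triangle_ineq4)
    also have "\<dots> \<le> 2 * B" using B[OF y] B[of p] p P(1) by fastforce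
    finally show "norm (F n y) \<le> 2 * B" unfolding F_def by (simp add: infdist_nonneg)
  next
    fix y and e :: real assume "y \<in> K" "0 < e"
    moreover have "norm (F n y - F n y') < e" if "norm (y - y') < e" for n y'
      using that infdist_triangle_abs[of y "P n" y'] unfolding F_def by (simp add: dist_norm)
    ultimately show "\<exists>d. 0 < d \<and> (\<forall>n y'. y' \<in> K \<and> norm (y - y') < d \<longrightarrow> norm (F n y - F n y') < e)"
      by blast
  qed blast
  have F0: "F n y = 0" if "y \<in> P n" for n y unfolding F_def using that by simp
  have small: "\<exists>N. \<forall>n\<ge>N. \<forall>y\<in>P (k n). \<bar>g y\<bar> < e" if e: "0 < e" for e
  proof -
    obtain N where N: "\<And>n y. n \<ge> N \<Longrightarrow> y \<in> K \<Longrightarrow> norm (F (k n) y - g y) < e"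
      using gk(3)[OF e] by blast
    have "\<bar>g y\<bar> < e" if "n \<ge> N" "y \<in> P (k n)" for n y
      using N[OF that(1), of y] F0[OF that(2)] that P(1) by fastforce
    then show ?thesis by blast
  qed
  define L where "L = {y \<in> K. g y = 0}"
  have pos: "\<exists>m>0. \<forall>y\<in>M. m \<le> \<bar>g y\<bar>" if M: "compact M" "M \<subseteq> K" "M \<inter> L = {}" for M
  proof (cases "M = {}")
    case False
    have "continuous_on M (\<lambda>y. \<bar>g y\<bar>)"
      by (rule continuous_on_rabs[OF continuous_on_subset[OF gk(1) M(2)]])
    then obtain m where m: "m \<in> M" "\<forall>y\<in>M. \<bar>g m\<bar> \<le> \<bar>g y\<bar>"
      using continuous_attains_inf[OF M(1) False] by blast
    moreover have "\<bar>g m\<bar> > 0" using m(1) M unfolding L_def by auto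
    ultimately show ?thesis by blast
  qed (use zero_less_one in blast)
  \<comment> \<open>On \<open>M\<close> the limit \<open>g\<close> is bounded away from 0, whereas
    it is uniformly small on late sets \<open>P (k n)\<close>. This gives both that \<open>L\<close>
    is nonempty and that late sets lie close to \<open>L\<close>.\<close>
  have avoid: "\<exists>N. \<forall>n\<ge>N. P (k n) \<inter> M = {}" if M: "compact M" "M \<subseteq> K" "M \<inter> L = {}" for M
  proof -
    obtain m where m: "m > 0" "\<forall>y\<in>M. m \<le> \<bar>g y\<bar>" using pos[OF M] by blast
    obtain N where "\<forall>n\<ge>N. \<forall>y\<in>P (k n). \<bar>g y\<bar> < m" using small[OF m(1)] by blast
    then have "\<forall>n\<ge>N. P (k n) \<inter> M = {}" using m(2) by fastforce
    then show ?thesis by blast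
  qed
  have L: "compact L"
  proof -
    have "L = K \<inter> g -` {0}" unfolding L_def by auto
    then show ?thesis using continuous_closed_preimage[OF gk(1) compact_imp_closed[OF K], of "{0}"] K
      by (metis closed_singleton compact_Int_closed inf.idem inf_left_idem)
  qed
  have Lne: "L \<noteq> {}"
  proof
    assume "L = {}"
    then obtain N where "\<forall>n\<ge>N. P (k n) \<inter> K = {}" using avoid[of K] K by blast
    then show False using P[of "k N"] by blast
  qed
  have "hausdorff_converges (P \<circ> k) L"
    unfolding hausdorff_converges_def
  proof (intro allI impI)
    fix e :: real assume e: "0 < e"
    let ?M = "K \<inter> {y. e \<le> infdist y L}"
    have "compact ?M" using K
      by (intro compact_Int_closed closed_Collect_le continuous_intros)
    moreover have "?M \<inter> L = {}" using e by auto
    ultimately obtain N where N: "\<And>n. n \<ge> N \<Longrightarrow> P (k n) \<inter> ?M = {}" using avoid[of ?M] by blast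
    obtain N' where N': "\<And>n y. n \<ge> N' \<Longrightarrow> y \<in> K \<Longrightarrow> norm (F (k n) y - g y) < e"
      using gk(3)[OF e] by blast
    show "\<forall>\<^sub>F n in sequentially. (\<forall>p\<in>(P \<circ> k) n. infdist p L < e) \<and> (\<forall>q\<in>L. infdist q ((P \<circ> k) n) < e)"
      unfolding eventually_sequentially
    proof (intro exI[of _ "max N N'"] allI impI conjI ballI)
      fix n p assume "max N N' \<le> n" "p \<in> (P \<circ> k) n"
      then have "p \<in> P (k n)" "p \<notin> ?M" "p \<in> K" using N[of n] P(1) by auto
      then show "infdist p L < e" by auto
    next
      fix n q assume n: "max N N' \<le> n" and q: "q \<in> L"
      then have "norm (F (k n) q - g q) < e" using N'[of n q] unfolding L_def by simp
      then show "infdist q ((P \<circ> k) n) < e" using q unfolding L_def F_def by (simp add: infdist_nonneg)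
    qed
  qed
  then show thesis using that[OF gk(2) L Lne] unfolding L_def by blast
qed

text \<open>Otherwise the compact set \<open>T\<close> would keep a positive distance from
  \<open>L\<close>, and a late \<open>P n\<close>, lying closer to \<open>L\<close> than that, could
  not meet \<open>T\<close>.\<close>

lemma hausdorff_limit_meets:
  assumes "hausdorff_converges P L" "compact L" "L \<noteq> {}" "compact T" "\<And>n. P n \<inter> T \<noteq> {}"
  shows "L \<inter> T \<noteq> {}"
proof
  assume dis: "L \<inter> T = {}"
  have "T \<noteq> {}" using assms(5) by blast
  moreover have "continuous_on T (\<lambda>y. infdist y L)" by (intro continuous_intros)
  ultimately obtain m where m: "m \<in> T" "\<forall>y\<in>T. infdist m L \<le> infdist y L"
    using continuous_attains_inf[OF assms(4)] by blast
  have "0 < infdist m L"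
    using m(1) dis assms(2,3) by (metis IntI compact_imp_closed empty_iff in_closed_iff_infdist_zero infdist_nonneg less_eq_real_def)
  then obtain n where "\<forall>p\<in>P n. infdist p L < infdist m L"
    using assms(1) unfolding hausdorff_converges_def eventually_sequentially by blast
  then show False using assms(5)[of n] m(2) by fastforce
qed

text \<open>Because \<open>r < e\<close>, each point \<open>w\<close> in question has a small subarc
  of \<open>J\<close> around it clear of the closed caps of radius \<open>r\<close>; by
  \<open>no_three_continua\<close>, three of the \<open>Q n\<close> cannot meet it. By compactness
  finitely many such subarcs suffice.\<close>

lemma finitely_many_touch:
  assumes J: "simple_closed_curve J" and xz: "x \<in> S2" "z \<in> S2" and r: "0 < r" "r < e" "r < 2"
    and disj: "cball x r \<inter> cball z r = {}"
    and U: "connected U" "U \<subseteq> S2 - J"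
    and Q: "\<And>n. n \<in> A \<Longrightarrow> compact (Q n)" "\<And>n. n \<in> A \<Longrightarrow> connected (Q n)"
      "\<And>n. n \<in> A \<Longrightarrow> Q n \<subseteq> closure U" "\<And>n. n \<in> A \<Longrightarrow> Q n \<inter> ball x r = {}"
      "\<And>n. n \<in> A \<Longrightarrow> Q n \<inter> ball z r = {}" "\<And>n. n \<in> A \<Longrightarrow> Q n \<inter> sphere x r \<noteq> {}"
      "\<And>n. n \<in> A \<Longrightarrow> Q n \<inter> sphere z r \<noteq> {}"
    and Qdisj: "\<And>m n. m \<in> A \<Longrightarrow> n \<in> A \<Longrightarrow> m \<noteq> n \<Longrightarrow> Q m \<inter> Q n = {}"
  shows "finite {n \<in> A. Q n \<inter> (J - (ball x e \<union> ball z e)) \<noteq> {}}"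
proof -
  let ?M = "J - (ball x e \<union> ball z e)"
  have cM: "compact ?M" using simple_closed_curve_compact(1)[OF J] by (intro compact_diff open_Un open_ball)
  have "\<exists>V. open V \<and> w \<in> V \<and> finite {n \<in> A. Q n \<inter> (J \<inter> V) \<noteq> {}}" if w: "w \<in> ?M" for w
  proof -
    have "open (- (cball x r \<union> cball z r))" by (intro open_Compl closed_Un closed_cball)
    moreover have "w \<in> - (cball x r \<union> cball z r)" using w r by auto
    ultimately obtain V where V: "open V" "w \<in> V" "J \<inter> V \<subseteq> - (cball x r \<union> cball z r)" "connected (J \<inter> V)"
      "connected (J - J \<inter> V)" "compact (J - J \<inter> V)"
      using simple_closed_curve_small_arc[OF J, of w] w by blast
    have "finite {n \<in> A. Q n \<inter> (J \<inter> V) \<noteq> {}}"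
    proof (rule ccontr)
      assume "infinite {n \<in> A. Q n \<inter> (J \<inter> V) \<noteq> {}}"
      then obtain I where I: "I \<subseteq> {n \<in> A. Q n \<inter> (J \<inter> V) \<noteq> {}}" "card I = 3"
        using infinite_arbitrarily_large by blast
      have IA: "n \<in> A" "Q n \<inter> (J \<inter> V) \<noteq> {}" if "n \<in> I" for n using I(1) that by blast+
      show False
      proof (rule no_three_continua[OF J _ V(4-6) xz r(1,3) disj _ _ U I(2), of Q])
        show "J \<inter> V \<inter> cball x r = {}" "J \<inter> V \<inter> cball z r = {}" using V(3) by blast+
        show "Q m \<inter> Q n = {}" if "m \<in> I" "n \<in> I" "m \<noteq> n" for m n
          using Qdisj IA that by blast
      qed (simp_all only: IA Q Int_lower1 simp_thms not_False_eq_True)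
    qed
    then show ?thesis using V by blast
  qed
  then have "\<forall>w\<in>?M. \<exists>V. open V \<and> w \<in> V \<and> finite {n \<in> A. Q n \<inter> (J \<inter> V) \<noteq> {}}" by (rule ballI)
  from bchoice[OF this] obtain V where V: "\<And>w. w \<in> ?M \<Longrightarrow> open (V w)" "\<And>w. w \<in> ?M \<Longrightarrow> w \<in> V w"
    "\<And>w. w \<in> ?M \<Longrightarrow> finite {n \<in> A. Q n \<inter> (J \<inter> V w) \<noteq> {}}" by blast
  obtain W where W: "W \<subseteq> ?M" "finite W" "?M \<subseteq> (\<Union>w\<in>W. V w)"
  proof (rule compactE_image[OF cM, of ?M V])
    show "?M \<subseteq> (\<Union>w\<in>?M. V w)" using V(2) by blast
  qed (simp_all only: V(1))
  have "{n \<in> A. Q n \<inter> ?M \<noteq> {}} \<subseteq> (\<Union>w\<in>W. {n \<in> A. Q n \<inter> (J \<inter> V w) \<noteq> {}})"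
    using W(3) by blast
  moreover have "finite (\<Union>w\<in>W. {n \<in> A. Q n \<inter> (J \<inter> V w) \<noteq> {}})" using W V(3) by blast
  ultimately show ?thesis by (rule finite_subset)
qed


subsection \<open>The closure of the Schoenflies relation\<close>

text \<open>This passes from \<open>closure U \<inter> K\<close> to \<open>K\<close>. By Sura-Bura
  the piece \<open>Q'\<close>, which misses \<open>J\<close>, has a clopen neighbourhood
  \<open>E\<close> in the trimmed set that misses \<open>J\<close> too and thus lies in
  \<open>U\<close>. As \<open>U\<close> is open in the sphere, \<open>E\<close> is clopen in
  \<open>K - B'\<close> as well, so the component \<open>C\<close> cannot leave it.\<close>

lemma trimmed_component_subset:
  fixes K :: "(real^3) set"
  assumes K: "compact K" "K \<subseteq> S2" and J: "closed J" and U: "U \<in> components (S2 - J)"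
    and P: "P \<in> components (closure U \<inter> K)"
    and B: "open B" "B \<subseteq> B'" "open B'"
    and Q: "Q \<in> components (P - B)" and Q': "Q' \<in> components (Q - B')" "Q' \<inter> J = {}"
    and C: "C \<in> components (K - B')" "Q' \<subseteq> C"
  shows "C \<subseteq> P"
proof -
  let ?S = "closure U \<inter> K - B'"
  have PK: "P \<subseteq> closure U \<inter> K" and QP: "Q \<subseteq> P - B" and QQ: "Q' \<subseteq> Q - B'" and CK: "C \<subseteq> K - B'"
    using P Q Q' C in_components_subset by blast+
  have conn: "connected Q'" "connected C" using Q' C in_components_connected by blast+
  have ne: "Q' \<noteq> {}" using Q' in_components_nonempty by blast
  have cS: "compact ?S" using K B(3) by (intro compact_diff closed_Int_compact) auto
  \<comment> \<open>The two successive trimmings collapse into one: a connected set in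
    \<open>?S\<close> around \<open>Q'\<close> stays in \<open>P\<close>, then in \<open>Q\<close>,
    as \<open>B \<subseteq> B'\<close>, then in \<open>Q'\<close>.\<close>
  have comp: "Q' \<in> components ?S"
    unfolding in_components_maximal
  proof (intro conjI allI impI)
    show "Q' \<subseteq> ?S" using QQ QP PK by blast
    fix D assume D: "D \<noteq> {} \<and> Q' \<subseteq> D \<and> D \<subseteq> ?S \<and> connected D"
    have "D \<subseteq> P" using components_maximal[OF P, of D] D QQ QP ne by blast
    then have "D \<subseteq> Q" using components_maximal[OF Q, of D] D QQ ne B(2) by blast
    then show "D = Q'" using components_maximal[OF Q'(1), of D] D ne by blast
  qed (use ne conn in auto)
  have "compact Q'" using compact_components[OF cS comp] .
  then obtain E where E: "openin (top_of_set ?S) E" "compact E" "Q' \<subseteq> E" "E \<subseteq> - J"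
    using Sura_Bura_clopen_subset[OF closed_imp_locally_compact[OF compact_imp_closed[OF cS]] comp, of "- J"] J Q'(2) by blast
  obtain O1 where O1: "open O1" "E = ?S \<inter> O1" using E(1) unfolding openin_open by blast
  have "openin (top_of_set S2) (S2 - J)"
    using J by (metis Diff_eq open_Compl openin_open_Int)
  moreover have "locally connected S2" by (rule locally_connected_sphere)
  ultimately have "openin (top_of_set S2) U"
    using U by (metis components_iff locally_connected_open_component)
  then obtain G where G: "open G" "U = S2 \<inter> G" unfolding openin_open by blast
  \<comment> \<open>A component of \<open>S2 - J\<close> is closed relative to
    \<open>S2 - J\<close>.\<close>
  have "closure U - J \<subseteq> U"
  proof -
    have "closedin (top_of_set (S2 - J)) U" using U by (rule closedin_component)
    then obtain T where T: "closed T" "U = (S2 - J) \<inter> T" unfolding closedin_closed by blast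
    then have "closure U \<subseteq> T" by (intro closure_minimal) auto
    moreover have "closure U \<subseteq> S2" using G by (intro closure_minimal) auto
    ultimately show ?thesis using T(2) by blast
  qed
  then have EU: "E \<subseteq> U" using E(4) O1(2) by blast
  have "O1 \<inter> G \<inter> (K - B') \<subseteq> E" using G(2) O1(2) K(2) closure_subset[of U] by blast
  then have eq: "O1 \<inter> G \<inter> C = E \<inter> C" using EU G(2) O1(2) CK by blast
  have "open (O1 \<inter> G)" "open (- E)"
    by (rule open_Int[OF O1(1) G(1)], rule open_Compl[OF compact_imp_closed[OF E(2)]])
  moreover have "C \<subseteq> (O1 \<inter> G) \<union> - E" using eq by blast
  moreover have "(O1 \<inter> G) \<inter> - E \<inter> C = {}" using eq by blast
  ultimately have "(O1 \<inter> G) \<inter> C = {} \<or> - E \<inter> C = {}" using connectedD[OF conn(2)] by blast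
  moreover have "(O1 \<inter> G) \<inter> C \<noteq> {}" using eq E(3) C(2) ne by blast
  ultimately have "C \<subseteq> E" by blast
  then have "C \<subseteq> closure U \<inter> K" using O1(2) by blast
  then show ?thesis
    using components_maximal[OF P conn(2)] C(2) QQ QP ne by blast
qed

text \<open>The witnessing curves are small round circles about \<open>x\<close> and \<open>z\<close>. The components crossing the
  annulus between them are found inside the \<open>P n\<close>, once those finitely many \<open>n\<close> are
  discarded whose crossing piece touches \<open>J1 \<union> J2\<close>, where \<open>K\<close> outside of \<open>U\<close> could join the pieces.\<close>
lemma schoenflies_closure:
  fixes K :: "(real^3) set"
  assumes K: "compact K" "K \<subseteq> S2" and J: "simple_closed_curve J1" "simple_closed_curve J2"
    and U: "U \<in> components (S2 - (J1 \<union> J2))"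
    and P: "inj P" "\<And>n. P n \<in> components (closure U \<inter> K)"
    and xz: "x \<in> S2" "z \<in> S2" "x \<noteq> z"
    and near: "\<And>e. e > 0 \<Longrightarrow> \<forall>\<^sub>F n in sequentially. P n \<inter> ball x e \<noteq> {} \<and> P n \<inter> ball z e \<noteq> {}"
  shows "(x, z) \<in> closure (schoenflies_rel K)"
  unfolding closure_approachable
proof (intro allI impI)
  fix e0 :: real assume e0: "0 < e0"
  \<comment> \<open>The three bounds serve, in this order, the closeness of the witness pair to
    \<open>(x, z)\<close>, the existence of circles of radius \<open>e\<close>, and the disjointness
    of the closed caps.\<close>
  define e where "e = min (min (e0 / 3) 1) (dist x z / 3)"
  have e: "0 < e" "e < 2" "2 * e < e0" "2 * e < dist x z"
    unfolding e_def using e0 xz(3) by (auto simp: min_def)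
  \<comment> \<open>Crossing pieces are first cut at this smaller radius, as
    \<open>finitely_many_touch\<close> wants room between \<open>r\<close> and \<open>e\<close>, and
    then again at \<open>e\<close>.\<close>
  define r where "r = e / 2"
  have r: "0 < r" "r < e" "r < 2" unfolding r_def using e by auto
  have disj: "cball x e \<inter> cball z e = {}"
  proof -
    have False if "dist x y \<le> e" "dist z y \<le> e" for y
      using dist_triangle2[of x z y] that e(4) by linarith
    then show ?thesis by auto
  qed
  have rsub: "ball x r \<subseteq> ball x e" "ball z r \<subseteq> ball z e" "cball x r \<subseteq> cball x e" "cball z r \<subseteq> cball z e"
    "sphere x r \<subseteq> cball x e" "sphere z r \<subseteq> cball z e"
    using r by auto
  then have disj_r: "cball x r \<inter> cball z r = {}" using disj by blast
  obtain N where N: "\<And>n. n \<ge> N \<Longrightarrow> P n \<inter> ball x r \<noteq> {} \<and> P n \<inter> ball z r \<noteq> {}"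
    using near[OF r(1)] unfolding eventually_sequentially by blast
  have cP: "compact (P n)" "connected (P n)" "P n \<subseteq> closure U \<inter> K" for n
    by (rule compact_components[OF closed_Int_compact[OF closed_closure K(1)] P(2)],
        rule in_components_connected[OF P(2)], rule in_components_subset[OF P(2)])
  have Pdisj: "P m \<inter> P n = {}" if "m \<noteq> n" for m n
    using components_nonoverlap[OF P(2)[of m] P(2)[of n]] P(1) that by (auto dest: injD)
  let ?A = "{N..}"
  have "\<forall>n\<in>?A. \<exists>Q. Q \<in> components (P n - (ball x r \<union> ball z r)) \<and> Q \<inter> sphere x r \<noteq> {} \<and> Q \<inter> sphere z r \<noteq> {}"
  proof
    fix n assume "n \<in> ?A"
    then have "P n \<inter> cball x r \<noteq> {}" "P n \<inter> cball z r \<noteq> {}" using N[of n] ball_subset_cball by fastforce+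
    then show "\<exists>Q. Q \<in> components (P n - (ball x r \<union> ball z r)) \<and> Q \<inter> sphere x r \<noteq> {} \<and> Q \<inter> sphere z r \<noteq> {}"
      using crossing_component[OF cP(1,2) disj_r] by metis
  qed
  from bchoice[OF this] obtain Q where Q: "\<And>n. n \<in> ?A \<Longrightarrow> Q n \<in> components (P n - (ball x r \<union> ball z r))"
    "\<And>n. n \<in> ?A \<Longrightarrow> Q n \<inter> sphere x r \<noteq> {}" "\<And>n. n \<in> ?A \<Longrightarrow> Q n \<inter> sphere z r \<noteq> {}" by blast
  have Qc: "compact (Q n)" "connected (Q n)" "Q n \<subseteq> P n - (ball x r \<union> ball z r)" if "n \<in> ?A" for n
  proof -
    have "compact (P n - (ball x r \<union> ball z r))" using cP(1) by (intro compact_diff open_Un open_ball)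
    then show "compact (Q n)" using compact_components Q(1)[OF that] by blast
    show "connected (Q n)" using Q(1)[OF that] by (rule in_components_connected)
    show "Q n \<subseteq> P n - (ball x r \<union> ball z r)" using Q(1)[OF that] by (rule in_components_subset)
  qed
  have US: "connected U" "U \<subseteq> S2 - (J1 \<union> J2)" using U in_components_connected in_components_subset by blast+
  have fin: "finite {n \<in> ?A. Q n \<inter> (J - (ball x e \<union> ball z e)) \<noteq> {}}" if "J = J1 \<or> J = J2" for J
  proof (rule finitely_many_touch[OF _ xz(1,2) r disj_r US(1)])
    show "simple_closed_curve J" "U \<subseteq> S2 - J" using that J US(2) by blast+
    show "Q n \<subseteq> closure U" "Q n \<inter> ball x r = {}" "Q n \<inter> ball z r = {}" if "n \<in> ?A" for n
      using Qc(3)[OF that] cP(3)[of n] by blast+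
    show "Q m \<inter> Q n = {}" if "m \<in> ?A" "n \<in> ?A" "m \<noteq> n" for m n
      using Qc(3)[OF that(1)] Qc(3)[OF that(2)] Pdisj[OF that(3)] by blast
  qed (simp_all only: Qc Q simp_thms not_False_eq_True)
  \<comment> \<open>The indices whose crossing piece touches \<open>J1 \<union> J2\<close> at most
    within the caps of radius \<open>e\<close>, which are trimmed away next.\<close>
  define A' where "A' = ?A - ({n \<in> ?A. Q n \<inter> (J1 - (ball x e \<union> ball z e)) \<noteq> {}}
      \<union> {n \<in> ?A. Q n \<inter> (J2 - (ball x e \<union> ball z e)) \<noteq> {}})"
  have infA: "infinite A'" unfolding A'_def
    using fin by (intro Diff_infinite_finite finite_UnI) (auto simp: infinite_Ici)
  let ?B = "ball x e \<union> ball z e"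
  \<comment> \<open>\<open>C\<close> is a component of all of \<open>K - ?B\<close>, as the new
    curves require; since it lies in \<open>P n\<close>, distinct indices will give distinct
    components.\<close>
  have "\<forall>n\<in>A'. \<exists>C. C \<in> components (K - ?B) \<and> C \<subseteq> P n \<and> C \<inter> sphere x e \<noteq> {} \<and> C \<inter> sphere z e \<noteq> {}"
  proof
    fix n assume n: "n \<in> A'"
    then have nA: "n \<in> ?A" and QJ: "Q n \<inter> (J1 \<union> J2) \<subseteq> ?B" unfolding A'_def by blast+
    have "Q n \<inter> cball x e \<noteq> {}" "Q n \<inter> cball z e \<noteq> {}" using Q(2,3)[OF nA] rsub by blast+
    then obtain Q' where Q': "Q' \<in> components (Q n - ?B)" "Q' \<inter> sphere x e \<noteq> {}" "Q' \<inter> sphere z e \<noteq> {}"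
      using crossing_component[OF Qc(1,2)[OF nA] disj] by metis
    have QQ: "Q' \<subseteq> Q n - ?B" "connected Q'" "Q' \<noteq> {}"
      using Q'(1) in_components_subset in_components_connected in_components_nonempty by blast+
    have QK: "Q' \<subseteq> K - ?B" using QQ Qc(3)[OF nA] cP(3)[of n] by blast
    obtain C where C: "C \<in> components (K - ?B)" "Q' \<subseteq> C"
      using exists_component_superset[OF QK _ QQ(2)] QK QQ(3) by blast
    have "C \<subseteq> P n"
    proof (rule trimmed_component_subset[OF K _ U P(2) _ _ _ Q(1)[OF nA] Q'(1) _ C])
      show "closed (J1 \<union> J2)" using J simple_closed_curve_compact(1) compact_imp_closed by blast
      show "Q' \<inter> (J1 \<union> J2) = {}" using QQ QJ by blast
      show "ball x r \<union> ball z r \<subseteq> ?B" using rsub by blast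
    qed auto
    then show "\<exists>C. C \<in> components (K - ?B) \<and> C \<subseteq> P n \<and> C \<inter> sphere x e \<noteq> {} \<and> C \<inter> sphere z e \<noteq> {}"
      using C Q'(2,3) by blast
  qed
  from bchoice[OF this] obtain C where C: "\<And>n. n \<in> A' \<Longrightarrow> C n \<in> components (K - ?B)"
    "\<And>n. n \<in> A' \<Longrightarrow> C n \<subseteq> P n" "\<And>n. n \<in> A' \<Longrightarrow> C n \<inter> sphere x e \<noteq> {}" "\<And>n. n \<in> A' \<Longrightarrow> C n \<inter> sphere z e \<noteq> {}"
    by blast
  define T where "T = C \<circ> enumerate A'"
  have en: "enumerate A' n \<in> A'" for n using infA by (rule enumerate_in_set)
  have T: "T n \<in> components (K - ?B)" "T n \<inter> sphere x e \<noteq> {}" "T n \<inter> sphere z e \<noteq> {}" for n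
    unfolding T_def using C en by simp_all
  have TK: "T n \<subseteq> K" "T n \<noteq> {}" for n using T(1,2)[of n] in_components_subset by fast+
  have injT: "inj T"
  proof (rule injI)
    fix m n assume "T m = T n"
    then have "P (enumerate A' m) \<inter> P (enumerate A' n) \<noteq> {}"
      using C(2)[OF en] TK(2) unfolding T_def by (metis Int_greatest comp_apply subset_empty)
    then have "enumerate A' m = enumerate A' n" using Pdisj by blast
    then show "m = n" using infA by (metis enumerate_step le_enumerate linorder_neqE_nat enumerate_mono less_irrefl)
  qed
  obtain k L where kL: "strict_mono (k :: nat \<Rightarrow> nat)" "compact L" "L \<noteq> {}" "L \<subseteq> K" "hausdorff_converges (T \<circ> k) L"
    by (rule hausdorff_convergent_subsequence[of K T, OF K(1) TK])
  have "L \<inter> sphere x e \<noteq> {}"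
    using T(2) by (intro hausdorff_limit_meets[OF kL(5,2,3) compact_sphere]) (simp add: comp_apply del: mem_sphere)
  moreover have "L \<inter> sphere z e \<noteq> {}"
    using T(3) by (intro hausdorff_limit_meets[OF kL(5,2,3) compact_sphere]) (simp add: comp_apply del: mem_sphere)
  \<comment> \<open>The limit set meets the circles in points near \<open>x\<close> and
    \<open>z\<close>, not in \<open>x\<close> and \<open>z\<close> themselves; hence membership in
    the closure only.\<close>
  ultimately obtain x' z' where x': "x' \<in> L" "x' \<in> sphere x e" and z': "z' \<in> L" "z' \<in> sphere z e"
    by blast
  let ?J1 = "S2 \<inter> sphere x e" and ?J2 = "S2 \<inter> sphere z e" and ?U = "S2 - (cball x e \<union> cball z e)"
  have ss: "sphere x e \<inter> sphere z e = {}"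
    using disj sphere_cball by blast
  have "(x', z') \<in> schoenflies_rel K"
    unfolding schoenflies_rel_def
  proof (clarify, intro conjI exI)
    show "x' \<in> K" "z' \<in> K" "x' \<noteq> z'" using x' z' kL(4) ss by blast+
    show "simple_closed_curve ?J1" "simple_closed_curve ?J2" using simple_closed_curve_circle xz e by blast+
    show "?J1 \<inter> ?J2 = {}" using ss by blast
    show "x' \<in> ?J1" "z' \<in> ?J2" using x' z' kL(4) K(2) by blast+
    show "is_U ?J1 ?J2 ?U" using caps_annulus(2) xz e disj by blast
    show "inj (T \<circ> k)" using injT kL(1) by (simp add: inj_compose strict_mono_imp_inj_on)
    have "closure ?U \<inter> K = K - ?B" using caps_annulus(1)[OF xz(1,2) e(1,2) disj] K(2) by blast
    then show "\<forall>n. (T \<circ> k) n \<in> components (closure ?U \<inter> K)" using T(1) by simp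
    show "\<forall>n. (T \<circ> k) n \<inter> ?J1 \<noteq> {} \<and> (T \<circ> k) n \<inter> ?J2 \<noteq> {}"
    proof
      fix n
      show "(T \<circ> k) n \<inter> ?J1 \<noteq> {} \<and> (T \<circ> k) n \<inter> ?J2 \<noteq> {}"
        using T(2,3)[of "k n"] TK(1)[of "k n"] K(2) by (metis Int_assoc Int_absorb2 comp_apply order_trans)
    qed
  qed (use kL x' z' in auto)
  moreover have "dist (x', z') (x, z) < e0"
  proof -
    have "dist (x', z') (x, z) \<le> dist x' x + dist z' z"
      unfolding dist_prod_def using real_sqrt_sum_squares_triangle_ineq sqrt_sum_squares_le_sum[of "dist x' x" "dist z' z"] by simp
    then show ?thesis using x' z' e(3) by (simp add: dist_commute)
  qed
  ultimately show "\<exists>y\<in>schoenflies_rel K. dist y (x, z) < e0" by blast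
qed

section \<open>Connectedness of the fibers\<close>

theorem theorem4:
  fixes K :: "(real^3) set" and x :: "real^3"
  assumes "compact K" and "K \<subseteq> riemann_sphere" and "x \<in> K"
  shows "connected {y \<in> K. (x, y) \<in> closure (schoenflies_rel K)}"
proof (rule ccontr)
  let ?R = "closure (schoenflies_rel K)" and ?F = "{y \<in> K. (x, y) \<in> closure (schoenflies_rel K)}"
  have KS: "K \<subseteq> S2" using assms(2) unfolding riemann_sphere_def .
  have Keq: "?F = K \<inter> Pair x -` ?R" by auto
  have clF: "closed ?F" unfolding Keq
    by (intro closed_Int closed_vimage closed_closure compact_imp_closed[OF assms(1)] continuous_intros)
  assume "\<not> connected ?F"
  then obtain A0 B0 where AB0: "closed A0" "closed B0" "A0 \<inter> B0 = {}" "A0 \<noteq> {}" "B0 \<noteq> {}" "A0 \<union> B0 = ?F"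
    unfolding connected_closed_set[OF clF] by blast
  \<comment> \<open>The parts are named so that \<open>x\<close> is in \<open>A\<close>, into which
    it is inserted if need be: membership of \<open>x\<close> in the fiber is not
    presupposed.\<close>
  obtain A B where AB: "closed A" "closed B" "A \<inter> B = {}" "B \<noteq> {}" "?F \<subseteq> A \<union> B" "B \<subseteq> ?F" "x \<in> A"
  proof (cases "x \<in> B0")
    case True
    then show ?thesis using that[of B0 A0] AB0 by blast
  next
    case False
    then show ?thesis using that[of "insert x A0" B0] AB0 by (simp add: closed_insert) blast
  qed
  obtain W V where WV: "open W" "open V" "A \<subseteq> W" "B \<subseteq> V" "W \<inter> V = {}"
    using AB(1-3) separation_normal by metis
  obtain y where y: "y \<in> B" using AB(4) by blast
  then have "(x, y) \<in> ?R" using AB(6) by blast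
  then obtain s where s: "\<And>k. s k \<in> schoenflies_rel K" "s \<longlonglongrightarrow> (x, y)"
    unfolding closure_sequential by blast
  define M where "M = K - (W \<union> V)"
  have cM: "compact M" unfolding M_def using assms(1) WV by (intro compact_diff open_Un)
  have "open (W \<times> V)" using WV open_Times by blast
  moreover have "(x, y) \<in> W \<times> V" using AB(7) y WV by blast
  ultimately have "\<forall>\<^sub>F k in sequentially. s k \<in> W \<times> V" by (rule topological_tendstoD[OF s(2)])
  then obtain k0 where k0: "\<And>k. k \<ge> k0 \<Longrightarrow> s k \<in> W \<times> V"
    unfolding eventually_sequentially by blast
  \<comment> \<open>For each late pair, the components behind it eventually meet \<open>W\<close>
    and \<open>V\<close>, so being connected they meet \<open>M\<close>. A cluster point
    \<open>l\<close> of points chosen there forms a pair in \<open>?R\<close> with the first member,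
    by \<open>schoenflies_closure\<close>.\<close>
  have step: "\<exists>l\<in>M. (fst (s k), l) \<in> ?R" if k: "k \<ge> k0" for k
  proof -
    obtain a b where ab: "s k = (a, b)" by fastforce
    have aW: "a \<in> W" "b \<in> V" using k0[OF k] ab by auto
    obtain J1 J2 U P L where D: "a \<in> K" "simple_closed_curve J1" "simple_closed_curve J2" "is_U J1 J2 U"
      "inj P" "\<And>n. P n \<in> components (closure U \<inter> K)" "\<And>n. P n \<inter> J1 \<noteq> {}"
      "hausdorff_converges P L" "a \<in> L" "b \<in> L"
      using s(1)[of k] unfolding ab schoenflies_rel_def by blast
    have near: "\<forall>\<^sub>F n in sequentially. P n \<inter> ball q e \<noteq> {}" if "q \<in> L" "e > 0" for q e
    proof -
      have "\<forall>\<^sub>F n in sequentially. (\<forall>p\<in>P n. infdist p L < e) \<and> (\<forall>q\<in>L. infdist q (P n) < e)"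
        using D(8) that(2) unfolding hausdorff_converges_def by blast
      then show ?thesis
      proof (rule eventually_mono)
        fix n assume "(\<forall>p\<in>P n. infdist p L < e) \<and> (\<forall>q\<in>L. infdist q (P n) < e)"
        then have "infdist q (P n) < e" using that(1) by blast
        moreover have "P n \<noteq> {}" using D(7) by blast
        ultimately have "\<exists>p\<in>P n. dist q p < e"
          by (simp add: infdist_notempty cINF_less_iff bdd_below_image_dist) 
        then show "P n \<inter> ball q e \<noteq> {}" by auto
      qed
    qed
    obtain ea where ea: "ea > 0" "ball a ea \<subseteq> W" using WV(1) aW(1) openE by blast
    obtain eb where eb: "eb > 0" "ball b eb \<subseteq> V" using WV(2) aW(2) openE by blast
    obtain n0 where n0: "\<And>n. n \<ge> n0 \<Longrightarrow> P n \<inter> ball a ea \<noteq> {} \<and> P n \<inter> ball b eb \<noteq> {}"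
      using eventually_conj[OF near[OF D(9) ea(1)] near[OF D(10) eb(1)]]
      unfolding eventually_sequentially by blast
    have "\<exists>p. p \<in> P (n + n0) \<inter> M" for n
    proof -
      let ?P = "P (n + n0)"
      have "connected ?P" "?P \<subseteq> K" using D(6)[of "n + n0"] in_components_connected in_components_subset by blast+
      moreover have "W \<inter> ?P \<noteq> {}" "V \<inter> ?P \<noteq> {}" using n0[of "n + n0"] ea eb by auto
      ultimately have "\<not> ?P \<subseteq> W \<union> V" using connectedD[of ?P W V] WV by blast
      then show ?thesis using \<open>?P \<subseteq> K\<close> unfolding M_def by blast
    qed
    then obtain p where p: "\<And>n. p n \<in> P (n + n0)" "\<And>n. p n \<in> M" by (metis IntE)
    obtain l g where l: "l \<in> M" "strict_mono (g :: nat \<Rightarrow> nat)" "(p \<circ> g) \<longlonglongrightarrow> l"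
      using cM p(2) unfolding compact_def by metis
    let ?P = "\<lambda>n. P (g n + n0)"
    have "(a, l) \<in> ?R"
    proof (rule schoenflies_closure[OF assms(1) KS D(2,3), of U ?P])
      show "U \<in> components (S2 - (J1 \<union> J2))" using D(4) unfolding is_U_def riemann_sphere_def by blast
      show "inj ?P" using D(5) l(2) unfolding inj_def strict_mono_def
        by (metis add_right_cancel linorder_neqE_nat less_irrefl)
      show "?P n \<in> components (closure U \<inter> K)" for n by (rule D(6))
      \<comment> \<open>The two points differ because \<open>a\<close> is in \<open>W\<close> and
        \<open>l\<close>, being in \<open>M\<close>, is not.\<close>
      show "a \<in> S2" "l \<in> S2" "a \<noteq> l" using D(1) l(1) KS aW(1) unfolding M_def by blast+
      fix e :: real assume e: "e > 0"
      have "filterlim (\<lambda>n. g n + n0) sequentially sequentially"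
        using filterlim_subseq[OF l(2)] filterlim_add_const_nat_at_top filterlim_compose by blast
      then have "\<forall>\<^sub>F n in sequentially. ?P n \<inter> ball a e \<noteq> {}"
        using eventually_compose_filterlim[OF near[OF D(9) e]] by blast
      moreover have "\<forall>\<^sub>F n in sequentially. dist ((p \<circ> g) n) l < e" using l(3) e by (rule tendstoD)
      then have "\<forall>\<^sub>F n in sequentially. ?P n \<inter> ball l e \<noteq> {}"
      proof (rule eventually_mono)
        fix n assume "dist ((p \<circ> g) n) l < e"
        then have "p (g n) \<in> ?P n \<inter> ball l e" using p(1) by (simp add: dist_commute)
        then show "?P n \<inter> ball l e \<noteq> {}" by blast
      qed
      ultimately show "\<forall>\<^sub>F n in sequentially. ?P n \<inter> ball a e \<noteq> {} \<and> ?P n \<inter> ball l e \<noteq> {}"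
        by (rule eventually_conj)
    qed
    then show ?thesis using l(1) ab by auto
  qed
  then have "\<forall>k. \<exists>l. l \<in> M \<and> (fst (s (k + k0)), l) \<in> ?R" by (meson le_add2)
  then obtain l where l: "\<And>k. l k \<in> M" "\<And>k. (fst (s (k + k0)), l k) \<in> ?R" by metis
  obtain l' g where l': "l' \<in> M" "strict_mono (g :: nat \<Rightarrow> nat)" "(l \<circ> g) \<longlonglongrightarrow> l'"
    using cM l(1) unfolding compact_def by metis
  have "(\<lambda>k. fst (s k)) \<longlonglongrightarrow> x" using tendsto_fst[OF s(2)] by simp
  then have "(\<lambda>k. fst (s (k + k0))) \<longlonglongrightarrow> x" by (rule LIMSEQ_ignore_initial_segment)
  then have "(\<lambda>k. fst (s (g k + k0))) \<longlonglongrightarrow> x" using LIMSEQ_subseq_LIMSEQ[OF _ l'(2)] by (fastforce simp: o_def)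
  then have "(\<lambda>k. (fst (s (g k + k0)), (l \<circ> g) k)) \<longlonglongrightarrow> (x, l')" using l'(3) by (rule tendsto_Pair)
  then have "(x, l') \<in> ?R" 
    using closed_sequentially[OF closed_closure] l(2) by fastforce
  then have "l' \<in> ?F" using l'(1) unfolding M_def by blast
  then show False using AB(5) WV l'(1) unfolding M_def by blast
qed

end
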